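(* For every $n\ge 1$ there is a bounded domain $D\subset\subset\mathbb{C}^n$ with the following property: for any two distinct points $p\neq q$ in $D$, if a holomorphic map $f:D\to D$ satisfies $f(p)=p$ and $f(q)=q$, then $f=\mathrm{id}$.
   Context: A domain is a connected nonempty open set. *)

theory Defs
  imports "HOL-Analysis.Analysis"
begin

definition is_domain :: "'a::topological_space set \<Rightarrow> bool" where
  "is_domain D \<longleftrightarrow> open D \<and> connected D \<and> D \<noteq> {}"

text \<open>
  The library's \<open>holomorphic_on\<close> covers functions of one complex variable only. A map of
  several complex variables is holomorphic on an open set if it has a complex-linear
  Frechet derivative at every point of the set; \<open>has_derivative\<close> by itself only gives
  real linearity.
\<close>

definition holomorphic_map_on ::
    "(complex ^ 'n \<Rightarrow> complex ^ 'm) \<Rightarrow> (complex ^ 'n) set \<Rightarrow> bool" where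
  "holomorphic_map_on f D \<longleftrightarrow>
     (\<forall>z\<in>D. \<exists>L. Vector_Spaces.linear (*s) (*s) L \<and> (f has_derivative L) (at z))"

end

theory Submission
  imports Defs "HOL-Complex_Analysis.Conformal_Mappings"
begin

text \<open>
  For \<open>n = 1\<close> the disc works, by the Schwarz lemma. For \<open>n \<ge> 2\<close> remove from the unit ball a sequence of walls,
  one in each of infinitely many disjoint closed spherical shells accumulating at the sphere; a wall is the part
  of a real hyperplane \<open>Re \<lambda> = t\<close> in its shell, where \<open>\<lambda> = z\<^sub>i + z\<^sub>k\<close> and \<open>t\<close> is rational, and each such
  pair \<open>(\<lambda>, t)\<close> is used infinitely often. What is left is connected, and by Hartogs extension a self-map \<open>f\<close>
  of it extends to a map \<open>F\<close> from the ball to the closed ball. If \<open>f\<close> fixes two points, \<open>F\<close> fixes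
  pointwise the slice of the ball by the complex line \<open>L\<close> through them (Schwarz lemma, strict convexity of the ball). If \<open>\<lambda>\<close> is not
  constant on \<open>L\<close>, then \<open>L\<close> crosses some wall of type \<open>\<lambda>\<close>. As \<open>F\<close> cannot map points off the wall into it,
  it preserves the hyperplane locally, and hence, a hyperplane being foliated by its complex leaves
  \<open>\<lambda> = const\<close>, also each leaf; thus \<open>\<lambda> \<circ> F = \<lambda>\<close> everywhere. These \<open>\<lambda>\<close> separate points.
\<close>

section \<open>Complex lines in C^n\<close>

lemma bounded_linear_vector_scalar_left: "bounded_linear (\<lambda>\<zeta>::complex. \<zeta> *s (v :: complex ^ 'n))"
  unfolding linear_conv_bounded_linear[symmetric]
  by (rule linearI) (simp_all add: vec_eq_iff algebra_simps)

lemma continuous_on_complex_line: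
  "continuous_on S (\<lambda>\<zeta>::complex. z + \<zeta> *s (v :: complex ^ 'n))"
  by (intro continuous_intros linear_continuous_on bounded_linear_vector_scalar_left)

lemma norm_vector_scalar: "norm (\<zeta> *s v) = cmod \<zeta> * norm (v :: complex ^ 'n)"
  by (simp add: norm_vec_def norm_mult L2_set_right_distrib)

lemma norm_axis_complex: "norm (axis k x :: complex ^ 'n) = cmod x"
proof -
  have "(norm ((axis k x :: complex ^ 'n) $ j))\<^sup>2 = (if j = k then (cmod x)\<^sup>2 else 0)" for j
    by (simp add: axis_def)
  then show ?thesis by (simp add: norm_vec_def L2_set_def)
qed

lemma open_complex_line_vimage:
  assumes "open C"
  shows "open {\<zeta>::complex. z + \<zeta> *s (v :: complex ^ 'n) \<in> C}"
  using open_vimage[OF assms continuous_on_complex_line[of UNIV z v]] by (simp add: vimage_def)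

lemma convex_complex_line_vimage:
  assumes "convex C"
  shows "convex {\<zeta>::complex. z + \<zeta> *s (v :: complex ^ 'n) \<in> C}"
proof (rule convexI)
  fix a b :: complex and s t :: real
  assume *: "a \<in> {\<zeta>. z + \<zeta> *s v \<in> C}" "b \<in> {\<zeta>. z + \<zeta> *s v \<in> C}" "0 \<le> s" "0 \<le> t" "s + t = 1"
  have "z + (s *\<^sub>R a + t *\<^sub>R b) *s v = (s + t) *\<^sub>R z + (s *\<^sub>R a + t *\<^sub>R b) *s v"
    by (simp add: *)
  also have "\<dots> = s *\<^sub>R (z + a *s v) + t *\<^sub>R (z + b *s v)"
    by (simp add: vec_eq_iff algebra_simps)
  finally show "s *\<^sub>R a + t *\<^sub>R b \<in> {\<zeta>. z + \<zeta> *s v \<in> C}"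
    using convexD[OF assms, of "z + a *s v" "z + b *s v" s t] * by simp
qed

section \<open>Continuous functions that are holomorphic on complex lines\<close>

text \<open>For open \<open>U\<close> this is holomorphy, by Osgood's lemma. The later arguments
  only restrict to complex lines, and a Cauchy integral with a parameter yields exactly this form
  without constructing a Frechet derivative.\<close>

definition line_holomorphic_on :: "(complex ^ 'n \<Rightarrow> complex) \<Rightarrow> (complex ^ 'n) set \<Rightarrow> bool" where
  "line_holomorphic_on g U \<longleftrightarrow> continuous_on U g \<and>
     (\<forall>z\<in>U. \<forall>v. (\<lambda>\<zeta>. g (z + \<zeta> *s v)) field_differentiable at 0)"

lemma line_holomorphic_on_subset:
  "line_holomorphic_on g U \<Longrightarrow> V \<subseteq> U \<Longrightarrow> line_holomorphic_on g V"
  unfolding line_holomorphic_on_def using continuous_on_subset by blast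

lemma line_holomorphic_on_line:
  assumes "line_holomorphic_on g U" "\<And>\<zeta>. \<zeta> \<in> S \<Longrightarrow> z + \<zeta> *s v \<in> U"
  shows "(\<lambda>\<zeta>. g (z + \<zeta> *s v)) holomorphic_on S"
  unfolding holomorphic_on_def
proof
  fix \<zeta> assume "\<zeta> \<in> S"
  then have "(\<lambda>\<eta>. g ((z + \<zeta> *s v) + \<eta> *s v)) field_differentiable at 0"
    using assms unfolding line_holomorphic_on_def by blast
  then obtain d where "((\<lambda>\<eta>. g ((z + \<zeta> *s v) + \<eta> *s v)) has_field_derivative d) (at 0)"
    unfolding field_differentiable_def by blast
  then have "((\<lambda>\<eta>. g ((z + \<zeta> *s v) + (\<eta> - \<zeta>) *s v)) has_field_derivative d) (at \<zeta>)"
    using DERIV_shift[of "\<lambda>\<eta>. g ((z + \<zeta> *s v) + (\<eta> - \<zeta>) *s v)" d 0 \<zeta>] by simp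
  moreover have "(z + \<zeta> *s v) + (\<eta> - \<zeta>) *s v = z + \<eta> *s v" for \<eta>
    by (simp add: vec_eq_iff algebra_simps)
  ultimately show "(\<lambda>\<eta>. g (z + \<eta> *s v)) field_differentiable at \<zeta> within S"
    unfolding field_differentiable_def using has_field_derivative_at_within by fastforce
qed

text \<open>The complex line through \<open>y\<close> and \<open>z\<close> meets \<open>C\<close> in
  a convex, hence connected, parameter set and \<open>W\<close> in an open one containing 0. The
  one-variable identity theorem then reaches the parameter 1, which is \<open>z\<close>.\<close>

lemma line_holomorphic_identity_convex:
  assumes "open C" "convex C" "line_holomorphic_on g C" "line_holomorphic_on h C"
    and W: "open W" "W \<subseteq> C" "y \<in> W" "\<And>z. z \<in> W \<Longrightarrow> g z = h z" and "z \<in> C"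
  shows "g z = h z"
proof -
  let ?S = "{\<zeta>. y + \<zeta> *s (z - y) \<in> C}" and ?T = "{\<zeta>. y + \<zeta> *s (z - y) \<in> W}"
  have "g (y + 1 *s (z - y)) = h (y + 1 *s (z - y))"
  proof (rule analytic_continuation_open[of ?T ?S "\<lambda>\<zeta>. g (y + \<zeta> *s (z - y))" "\<lambda>\<zeta>. h (y + \<zeta> *s (z - y))" 1])
    show "open ?S" "open ?T"
      using assms open_complex_line_vimage by blast+
    show "connected ?S"
      using convex_complex_line_vimage[OF \<open>convex C\<close>] convex_connected by blast
    have "0 \<in> ?T" using \<open>y \<in> W\<close> by simp
    then show "?T \<noteq> {}" by blast
    show "(\<lambda>\<zeta>. g (y + \<zeta> *s (z - y))) holomorphic_on ?S" "(\<lambda>\<zeta>. h (y + \<zeta> *s (z - y))) holomorphic_on ?S"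
      by (rule line_holomorphic_on_line[of _ C]; use assms in simp)+
  qed (use assms in auto)
  then show ?thesis by simp
qed

text \<open>The interior \<open>I\<close> of the coincidence set is also relatively closed in
  \<open>U\<close>: a ball in \<open>U\<close> that meets \<open>I\<close> lies in \<open>I\<close>,
  by the convex case. Connectedness gives \<open>I = U\<close>.\<close>

lemma line_holomorphic_identity:
  assumes U: "open U" "connected U" and gh: "line_holomorphic_on g U" "line_holomorphic_on h U"
    and W: "open W" "W \<subseteq> U" "W \<noteq> {}" "\<And>z. z \<in> W \<Longrightarrow> g z = h z" and "z \<in> U"
  shows "g z = h z"
proof -
  define I where "I = interior {z \<in> U. g z = h z}"
  have IU: "I \<subseteq> U" using interior_subset unfolding I_def by fast
  have eqI: "g y = h y" if "y \<in> I" for y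
    using that interior_subset unfolding I_def by fast
  have "W \<subseteq> I" unfolding I_def using W by (intro interior_maximal) auto
  have "open (U - I)"
    unfolding open_contains_ball
  proof
    fix y assume y: "y \<in> U - I"
    then obtain e where e: "e > 0" "ball y e \<subseteq> U"
      using U open_contains_ball by blast
    have "ball y e \<inter> I = {}"
    proof (rule ccontr)
      assume "ball y e \<inter> I \<noteq> {}"
      then obtain x where x: "x \<in> ball y e \<inter> I" by blast
      have "g w = h w" if "w \<in> ball y e" for w
      proof (rule line_holomorphic_identity_convex[of "ball y e" g h "ball y e \<inter> I" x])
        show "line_holomorphic_on g (ball y e)" "line_holomorphic_on h (ball y e)"
          using gh e line_holomorphic_on_subset by blast+
        show "open (ball y e \<inter> I)" unfolding I_def by auto
      qed (use that x eqI in auto)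
      then have "y \<in> I"
        unfolding I_def using e by (intro interiorI[of "ball y e"]) auto
      with y show False by blast
    qed
    with e show "\<exists>e>0. ball y e \<subseteq> U - I" by blast
  qed
  moreover have "open I" unfolding I_def by simp
  ultimately have "U - I = {}"
    using connectedD[OF \<open>connected U\<close>, of I "U - I"] IU \<open>W \<subseteq> I\<close> W by blast
  with \<open>z \<in> U\<close> eqI show ?thesis by blast
qed

lemma line_holomorphic_on_component:
  fixes f :: "complex ^ 'n \<Rightarrow> complex ^ 'm"
  assumes "holomorphic_map_on f D"
  shows "line_holomorphic_on (\<lambda>z. f z $ i) D"
  unfolding line_holomorphic_on_def
proof (intro conjI ballI allI continuous_at_imp_continuous_on)
  fix z assume z: "z \<in> D"
  obtain L where L: "Vector_Spaces.linear (*s) (*s) L" and d: "(f has_derivative L) (at z)"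
    using assms z unfolding holomorphic_map_on_def by force
  have di: "((\<lambda>z. f z $ i) has_derivative (\<lambda>w. L w $ i)) (at z)"
    by (rule bounded_linear.has_derivative[OF bounded_linear_vec_nth d])
  then show "isCont (\<lambda>z. f z $ i) z"
    by (rule has_derivative_continuous)
  fix v
  have "((\<lambda>\<zeta>. z + \<zeta> *s v) has_derivative (\<lambda>\<zeta>. \<zeta> *s v)) (at 0)"
    using has_derivative_add[OF has_derivative_const[of z] bounded_linear_imp_has_derivative[OF bounded_linear_vector_scalar_left[of v]]]
    by simp
  moreover have "((\<lambda>z. f z $ i) has_derivative (\<lambda>w. L w $ i)) (at (z + 0 *s v))"
    using di by simp
  ultimately have "((\<lambda>\<zeta>. f (z + \<zeta> *s v) $ i) has_derivative (\<lambda>\<zeta>. L (\<zeta> *s v) $ i)) (at 0)"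
    by (rule diff_chain_at[unfolded o_def])
  \<comment> \<open>Complex linearity of \<open>L\<close> enters here: the real derivative along the
    line is multiplication by one complex number.\<close>
  moreover have "(\<lambda>\<zeta>. L (\<zeta> *s v) $ i) = (*) (L v $ i)"
    by (rule ext) (simp add: vec.linear_scale[OF L])
  ultimately show "(\<lambda>\<zeta>. f (z + \<zeta> *s v) $ i) field_differentiable at 0"
    unfolding field_differentiable_def has_field_derivative_def by auto
qed

section \<open>Extension across spherical shells\<close>

lemma continuous_on_contour_integral_parameter:
  fixes H :: "'a::topological_space \<Rightarrow> complex \<Rightarrow> complex"
  assumes \<gamma>: "valid_path \<gamma>" "continuous_on {0..1} (\<lambda>t. vector_derivative \<gamma> (at t))"
    and cont: "continuous_on (U \<times> path_image \<gamma>) (\<lambda>(x, w). H x w)"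
  shows "continuous_on U (\<lambda>x. contour_integral \<gamma> (H x))"
proof -
  have \<gamma>c: "continuous_on {0..1} \<gamma>"
    using \<gamma>(1) valid_path_imp_path path_def by blast
  have "continuous_on (U \<times> cbox 0 1) ((\<lambda>(x, w). H x w) \<circ> (\<lambda>(x, t). (x, \<gamma> t)))"
    unfolding case_prod_unfold
    by (intro continuous_on_compose continuous_intros continuous_on_compose2[OF \<gamma>c]
        continuous_on_subset[OF cont[unfolded case_prod_unfold]])
      (auto simp: path_image_def)
  moreover have "continuous_on (U \<times> cbox 0 1) (\<lambda>(x, t). vector_derivative \<gamma> (at t))"
    unfolding case_prod_unfold by (rule continuous_on_compose2[OF \<gamma>(2)]) (auto intro!: continuous_intros)
  ultimately have "continuous_on (U \<times> cbox 0 1) (\<lambda>(x, t). H x (\<gamma> t) * vector_derivative \<gamma> (at t))"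
    unfolding case_prod_unfold o_def by (intro continuous_intros) auto
  from integral_continuous_on_param[OF this] show ?thesis
    by (simp add: contour_integral_integral)
qed

text \<open>Morera's theorem: after exchanging the two integrations, the integral around a triangle
  vanishes for each fixed \<open>w\<close> by Cauchy's theorem.\<close>

lemma holomorphic_on_contour_integral_parameter:
  assumes U: "open U"
    and \<gamma>: "valid_path \<gamma>" "continuous_on {0..1} (\<lambda>t. vector_derivative \<gamma> (at t))"
    and cont: "continuous_on (U \<times> path_image \<gamma>) (\<lambda>(x, w). H x w)"
    and hol: "\<And>w. w \<in> path_image \<gamma> \<Longrightarrow> (\<lambda>x. H x w) holomorphic_on U"
  shows "(\<lambda>x. contour_integral \<gamma> (H x)) holomorphic_on U"
proof (rule analytic_imp_holomorphic, rule Morera_triangle[OF _ U])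
  show cU: "continuous_on U (\<lambda>x. contour_integral \<gamma> (H x))"
    by (rule continuous_on_contour_integral_parameter[OF \<gamma> cont])
  show "convex hull {a, b, c} \<subseteq> U \<longrightarrow> contour_integral (linepath a b) (\<lambda>x. contour_integral \<gamma> (H x)) +
      contour_integral (linepath b c) (\<lambda>x. contour_integral \<gamma> (H x)) +
      contour_integral (linepath c a) (\<lambda>x. contour_integral \<gamma> (H x)) = 0" for a b c
  proof
    assume T: "convex hull {a, b, c} \<subseteq> U"
    have seg: "closed_segment a b \<subseteq> U" "closed_segment b c \<subseteq> U" "closed_segment c a \<subseteq> U"
      unfolding segment_convex_hull by (rule subset_trans[OF hull_mono T]; simp)+
    have sw: "contour_integral (linepath p q) (\<lambda>x. contour_integral \<gamma> (H x))
          = contour_integral \<gamma> (\<lambda>w. contour_integral (linepath p q) (\<lambda>x. H x w))"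
      if "closed_segment p q \<subseteq> U" for p q
      by (rule contour_integral_swap)
        (use that \<gamma> in \<open>auto intro!: continuous_on_subset[OF cont] continuous_intros\<close>)
    have ci: "(\<lambda>w. contour_integral (linepath p q) (\<lambda>x. H x w)) contour_integrable_on \<gamma>"
      if "closed_segment p q \<subseteq> U" for p q
    proof -
      have "continuous_on (path_image \<gamma>) (\<lambda>w. contour_integral (linepath p q) (\<lambda>x. H x w))"
      proof (rule continuous_on_contour_integral_parameter)
        have "continuous_on (path_image \<gamma> \<times> path_image (linepath p q)) ((\<lambda>(x, w). H x w) \<circ> prod.swap)"
          by (intro continuous_on_compose continuous_on_swap continuous_on_subset[OF cont]) (use that in auto)
        then show "continuous_on (path_image \<gamma> \<times> path_image (linepath p q)) (\<lambda>(w, x). H x w)"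
          by (simp add: o_def case_prod_unfold)
      qed (auto intro!: continuous_intros)
      moreover have "continuous_on {0..1} \<gamma>"
        using \<gamma>(1) valid_path_imp_path path_def by blast
      ultimately have "continuous_on {0..1} (\<lambda>t. contour_integral (linepath p q) (\<lambda>x. H x (\<gamma> t)))"
        by (rule continuous_on_compose2) (auto simp: path_image_def)
      then show ?thesis
        unfolding contour_integrable_on
        by (intro integrable_continuous_real continuous_on_mult \<gamma>(2))
    qed
    have "contour_integral (linepath a b) (\<lambda>x. H x w) + contour_integral (linepath b c) (\<lambda>x. H x w)
        + contour_integral (linepath c a) (\<lambda>x. H x w) = 0" if w: "w \<in> path_image \<gamma>" for w
    proof -
      have h: "(\<lambda>x. H x w) holomorphic_on convex hull {a, b, c}"
        using hol[OF w] T holomorphic_on_subset by blast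
      have "(\<lambda>x. H x w) contour_integrable_on linepath p q" if "closed_segment p q \<subseteq> U" for p q
        by (rule contour_integrable_continuous_linepath)
          (use hol[OF w] that holomorphic_on_imp_continuous_on holomorphic_on_subset in blast)
      then show ?thesis
        using Cauchy_theorem_triangle[OF h, THEN contour_integral_unique] seg
        by (simp add: add.assoc)
    qed
    then have "0 = contour_integral \<gamma> (\<lambda>w. contour_integral (linepath a b) (\<lambda>x. H x w) +
        contour_integral (linepath b c) (\<lambda>x. H x w) + contour_integral (linepath c a) (\<lambda>x. H x w))"
      by (subst contour_integral_eq[of \<gamma> _ "\<lambda>_. 0"]) simp_all
    also have "\<dots> = contour_integral (linepath a b) (\<lambda>x. contour_integral \<gamma> (H x)) +
        contour_integral (linepath b c) (\<lambda>x. contour_integral \<gamma> (H x)) +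
        contour_integral (linepath c a) (\<lambda>x. contour_integral \<gamma> (H x))"
      using seg by (simp add: contour_integral_add ci contour_integrable_add sw)
    finally show "contour_integral (linepath a b) (\<lambda>x. contour_integral \<gamma> (H x)) +
        contour_integral (linepath b c) (\<lambda>x. contour_integral \<gamma> (H x)) +
        contour_integral (linepath c a) (\<lambda>x. contour_integral \<gamma> (H x)) = 0" by simp
  qed
qed

text \<open>Allows an extension to be pieced together from Cauchy integrals over different circles,
  and later from extensions to smaller balls.\<close>

lemma line_holomorphic_on_local:
  assumes "\<And>z. z \<in> U \<Longrightarrow> \<exists>N g'. open N \<and> z \<in> N \<and> line_holomorphic_on g' N \<and> (\<forall>w\<in>N. g w = g' w)"
  shows "line_holomorphic_on g U"
  unfolding line_holomorphic_on_def
proof (intro conjI ballI allI continuous_at_imp_continuous_on)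
  fix z assume "z \<in> U"
  then obtain N g' where N: "open N" "z \<in> N" "line_holomorphic_on g' N" "\<forall>w\<in>N. g w = g' w"
    using assms by blast
  then have "continuous_on N g'"
    unfolding line_holomorphic_on_def by blast
  then have "continuous_on N g"
    using N continuous_on_cong by metis
  then show "isCont g z"
    using N continuous_on_eq_continuous_at by blast
  fix v
  obtain d where d: "((\<lambda>\<zeta>. g' (z + \<zeta> *s v)) has_field_derivative d) (at 0)"
    using N unfolding line_holomorphic_on_def field_differentiable_def by blast
  have "((\<lambda>\<zeta>. g (z + \<zeta> *s v)) has_field_derivative d) (at 0)"
  proof (rule has_field_derivative_transform_within_open[OF d])
    show "open {\<zeta>. z + \<zeta> *s v \<in> N}"
      by (rule open_complex_line_vimage[OF \<open>open N\<close>])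
  qed (use N in auto)
  then show "(\<lambda>\<zeta>. g (z + \<zeta> *s v)) field_differentiable at 0"
    unfolding field_differentiable_def by blast
qed

text \<open>Points of equal angle are joined by a radial segment, so the linear homotopy between the
  two circles stays in the closed annulus.\<close>

lemma contour_integral_circlepath_annulus:
  assumes "open S" "f holomorphic_on S" "r \<le> s" "{w. r \<le> cmod w \<and> cmod w \<le> s} \<subseteq> S" "0 < r"
  shows "contour_integral (circlepath 0 r) f = contour_integral (circlepath 0 s) f"
proof (rule Cauchy_theorem_homotopic_loops[OF homotopic_loops_linear \<open>open S\<close> assms(2)])
  fix t :: real
  define e where "e = exp (2 * complex_of_real pi * \<i> * complex_of_real t)"
  have [simp]: "cmod e = 1" by (simp add: e_def)
  show "closed_segment (circlepath 0 r t) (circlepath 0 s t) \<subseteq> S"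
  proof
    fix x assume "x \<in> closed_segment (circlepath 0 r t) (circlepath 0 s t)"
    then obtain u where u: "0 \<le> u" "u \<le> 1" "x = (1 - u) *\<^sub>R (r * e) + u *\<^sub>R (s * e)"
      unfolding closed_segment_def circlepath e_def by auto
    then have "x = of_real ((1 - u) * r + u * s) * e"
      by (simp add: scaleR_conv_of_real algebra_simps)
    then have "cmod x = \<bar>(1 - u) * r + u * s\<bar>"
      by (simp only: norm_mult norm_of_real \<open>cmod e = 1\<close> mult_1_right)
    moreover have "r \<le> (1 - u) * r + u * s" "(1 - u) * r + u * s \<le> s"
      using u assms mult_left_mono[of r s u] mult_left_mono[of r s "1 - u"] by (simp_all add: algebra_simps)
    ultimately show "x \<in> S" using assms by auto
  qed
qed (use assms in auto)

text \<open>The extension is given by the Cauchy integral in one coordinate, over a circle whose radius depends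
  on the other coordinates so that it stays in the shell.\<close>

lemma spherical_shell_extension:
  fixes g :: "complex ^ 'n \<Rightarrow> complex"
  assumes card: "CARD('n) \<ge> 2" and abc: "0 \<le> a" "a < c" "c < b"
    and U: "open U" "connected (U \<inter> ball 0 c)"
    and shell: "\<And>z. a < norm z \<Longrightarrow> norm z < b \<Longrightarrow> z \<in> U"
    and g: "line_holomorphic_on g U"
  obtains G where "line_holomorphic_on G (ball 0 c)" "\<And>z. z \<in> U \<Longrightarrow> norm z < c \<Longrightarrow> G z = g z"
proof -
  obtain i :: 'n where True by simp
  have "\<exists>k. k \<noteq> i"
  proof (rule ccontr)
    assume "\<nexists>k. k \<noteq> i"
    then have "UNIV = {i}" by auto
    then have "CARD('n) = card {i}" by (rule arg_cong)
    with card show False by simp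
  qed
  then obtain k where k: "k \<noteq> i" by blast
  define e :: "complex ^ 'n" where "e = axis i 1"
  define up where "up = (\<lambda>z (w::complex). z + (w - z $ i) *s e)"
  define q where "q = (\<lambda>z :: complex ^ 'n. \<Sum>j\<in>UNIV - {i}. (cmod (z $ j))\<^sup>2)"
  define H where "H = (\<lambda>z w. g (up z w) / (w - z $ i) / (2 * of_real pi * \<i>))"
  \<comment> \<open>\<open>up z w\<close> has squared norm \<open>(cmod w)^2 + q z\<close>. So
    \<open>N \<rho>\<close> consists of the \<open>z\<close> whose circle
    \<open>cmod w = \<rho>\<close> in the coordinate \<open>i\<close> lies in the shell and encloses
    \<open>z $ i\<close>. The radius in \<open>G\<close> puts this circle on the sphere of radius
    \<open>c\<close>.\<close>
  define N where "N = (\<lambda>\<rho>. {z. cmod (z $ i) < \<rho> \<and> a\<^sup>2 < q z + \<rho>\<^sup>2 \<and> q z + \<rho>\<^sup>2 < b\<^sup>2})"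
  define G where "G = (\<lambda>z. contour_integral (circlepath 0 (sqrt (c\<^sup>2 - q z))) (H z))"
  have up_i: "up z w $ i = w" and up_j: "j \<noteq> i \<Longrightarrow> up z w $ j = z $ j" for z w j
    by (simp_all add: up_def e_def axis_def)
  have up_self: "up z (z $ i) = z" for z
    by (simp add: up_def)
  have norm2: "(norm z)\<^sup>2 = (cmod (z $ i))\<^sup>2 + q z" for z :: "complex ^ 'n"
  proof -
    have "(norm z)\<^sup>2 = (\<Sum>j\<in>UNIV. (cmod (z $ j))\<^sup>2)"
      by (simp add: norm_vec_def L2_set_def sum_nonneg)
    then show ?thesis unfolding q_def by (subst (asm) sum.remove[of _ i]) auto
  qed
  have q0: "0 \<le> q z" for z
    unfolding q_def by (intro sum_nonneg) auto
  have norm_up: "(norm (up z w))\<^sup>2 = (cmod w)\<^sup>2 + q z" for z w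
  proof -
    have "q (up z w) = q z" unfolding q_def by (intro sum.cong) (auto simp: up_j)
    then show ?thesis using norm2[of "up z w"] by (simp add: up_i)
  qed
  have q_cont: "continuous_on S q" for S
    unfolding q_def by (intro continuous_intros)
  have openN: "open (N \<rho>)" for \<rho>
    unfolding N_def by (intro open_Collect_conj open_Collect_less continuous_intros q_cont)
  have sh: "z \<in> U" if "a\<^sup>2 < (norm z)\<^sup>2" "(norm z)\<^sup>2 < b\<^sup>2" for z
    using that abc by (intro shell) (auto intro: power_less_imp_less_base)
  have upU: "up z w \<in> U" if "z \<in> N \<rho>" "cmod w = \<rho>" for z w \<rho>
    using that by (intro sh) (auto simp: norm_up N_def add.commute)
  have up_line: "up z w = (z - z $ i *s e) + w *s e" for z w
    by (simp add: up_def vec_eq_iff algebra_simps)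
  have up_line': "up (z + \<zeta> *s v) w = up z w + \<zeta> *s (v - (v $ i) *s e)" for z \<zeta> v w
    by (simp add: up_def vec_eq_iff algebra_simps)
  have opU: "open {w. up z w \<in> U}" for z
    unfolding up_line[of z] by (rule open_complex_line_vimage[OF U(1)])
  have gup: "(\<lambda>w. g (up z w)) holomorphic_on S" if "\<And>w. w \<in> S \<Longrightarrow> up z w \<in> U" for z S
    unfolding up_line[of z] by (rule line_holomorphic_on_line[OF g]) (use that up_line in metis)
  have vd: "continuous_on {0..1} (\<lambda>t. vector_derivative (circlepath 0 \<rho>) (at t))" for \<rho>
    by (simp add: vector_derivative_circlepath) (intro continuous_intros)

  \<comment> \<open>By Cauchy's theorem the radius does not matter. Near each point
    \<open>G\<close>, whose radius varies, therefore equals an integral over one fixed circle, to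
    which \<open>hol\<close> applies.\<close>
  have indep: "contour_integral (circlepath 0 r) (H z) = contour_integral (circlepath 0 s) (H z)"
    if "z \<in> N r" "z \<in> N s" "r \<le> s" for z r s
  proof (rule contour_integral_circlepath_annulus)
    show "open ({w. up z w \<in> U} - {z $ i})"
      by (intro open_Diff opU) auto
    show "H z holomorphic_on ({w. up z w \<in> U} - {z $ i})"
      unfolding H_def by (intro holomorphic_intros gup) auto
    have r: "0 < r" using that unfolding N_def by (auto intro: le_less_trans[OF norm_ge_zero])
    then show "0 < r" .
    have "up z w \<in> U \<and> w \<noteq> z $ i" if w: "r \<le> cmod w" "cmod w \<le> s" for w
    proof -
      have "r\<^sup>2 \<le> (cmod w)\<^sup>2" "(cmod w)\<^sup>2 \<le> s\<^sup>2"
        using w r by (auto intro: power_mono)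
      then have "up z w \<in> U"
        using \<open>z \<in> N r\<close> \<open>z \<in> N s\<close> by (intro sh) (auto simp: norm_up N_def)
      moreover have "w \<noteq> z $ i"
        using w \<open>z \<in> N r\<close> by (auto simp: N_def)
      ultimately show ?thesis ..
    qed
    then show "{w. r \<le> cmod w \<and> cmod w \<le> s} \<subseteq> {w. up z w \<in> U} - {z $ i}" by blast
  qed fact
  have indep': "contour_integral (circlepath 0 r) (H z) = contour_integral (circlepath 0 s) (H z)"
    if "z \<in> N r" "z \<in> N s" for z r s
    using indep[of z r s] indep[of z s r] that by fastforce

  have hol: "line_holomorphic_on (\<lambda>z. contour_integral (circlepath 0 \<rho>) (H z)) (N \<rho>)" for \<rho>
  proof (cases "0 < \<rho>")
    case True
    then have pim: "path_image (circlepath 0 \<rho>) = {w. cmod w = \<rho>}"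
      by (auto simp: sphere_def)
    have upc: "continuous_on S (\<lambda>x. up (fst x) (snd x))" for S
      unfolding up_def
      by (intro continuous_intros linear_continuous_on_compose[where g = "\<lambda>\<zeta>. \<zeta> *s e"]
          bounded_linear.linear bounded_linear_vector_scalar_left)
    have cH: "continuous_on (N \<rho> \<times> path_image (circlepath 0 \<rho>)) (\<lambda>(z, w). H z w)"
      unfolding H_def case_prod_unfold
    proof (intro continuous_intros continuous_on_compose2[OF _ upc])
      show "continuous_on U g" using g unfolding line_holomorphic_on_def by blast
      show "(\<lambda>x. up (fst x) (snd x)) ` (N \<rho> \<times> path_image (circlepath 0 \<rho>)) \<subseteq> U"
        using True upU by (auto simp: pim)
      show "\<forall>x\<in>N \<rho> \<times> path_image (circlepath 0 \<rho>). snd x - fst x $ i \<noteq> 0"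
        using True by (auto simp: pim N_def)
    qed simp
    show ?thesis
      unfolding line_holomorphic_on_def
    proof (intro conjI ballI allI)
      show "continuous_on (N \<rho>) (\<lambda>z. contour_integral (circlepath 0 \<rho>) (H z))"
        by (intro continuous_on_contour_integral_parameter cH vd) simp
      fix z v assume z: "z \<in> N \<rho>"
      define S where "S = {\<zeta>. z + \<zeta> *s v \<in> N \<rho>}"
      have S: "open S" "0 \<in> S"
        using z open_complex_line_vimage[OF openN] by (auto simp: S_def)
      have "(\<lambda>\<zeta>. contour_integral (circlepath 0 \<rho>) (H (z + \<zeta> *s v))) holomorphic_on S"
      proof (rule holomorphic_on_contour_integral_parameter[OF S(1) _ vd])
        have "continuous_on (S \<times> path_image (circlepath 0 \<rho>))
            ((\<lambda>(z, w). H z w) \<circ> (\<lambda>x. (z + fst x *s v, snd x)))"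
          by (intro continuous_on_compose continuous_on_subset[OF cH] continuous_intros
              linear_continuous_on_compose[where g = "\<lambda>\<zeta>. \<zeta> *s v"]
              bounded_linear.linear bounded_linear_vector_scalar_left) (auto simp: S_def)
        then show "continuous_on (S \<times> path_image (circlepath 0 \<rho>)) (\<lambda>(\<zeta>, w). H (z + \<zeta> *s v) w)"
          by (simp add: o_def case_prod_unfold)
        fix w assume w: "w \<in> path_image (circlepath 0 \<rho>)"
        have U': "up z w + \<zeta> *s (v - v $ i *s e) \<in> U" if "\<zeta> \<in> S" for \<zeta>
          using that w True unfolding up_line'[symmetric] by (auto simp: pim S_def upU)
        have "(\<lambda>\<zeta>. g (up z w + \<zeta> *s (v - v $ i *s e)) / (w - (z $ i + \<zeta> * v $ i)) / (2 * of_real pi * \<i>)) holomorphic_on S"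
          by (intro holomorphic_intros line_holomorphic_on_line[OF g] U')
            (use w True in \<open>auto simp: pim S_def N_def\<close>)
        then show "(\<lambda>\<zeta>. H (z + \<zeta> *s v) w) holomorphic_on S"
          by (simp add: H_def up_line')
      qed simp
      then show "(\<lambda>\<zeta>. contour_integral (circlepath 0 \<rho>) (H (z + \<zeta> *s v))) field_differentiable at 0"
        using S by (simp add: holomorphic_on_imp_differentiable_at)
    qed
  next
    case False
    then have "N \<rho> = {}" unfolding N_def by (auto intro: le_less_trans[OF norm_ge_zero])
    then show ?thesis by (simp add: line_holomorphic_on_def)
  qed

  have adm: "z \<in> N (sqrt (c\<^sup>2 - q z))" if "norm z < c" for z
  proof -
    have "(norm z)\<^sup>2 < c\<^sup>2" using that by (intro power_strict_mono) auto
    then have "(cmod (z $ i))\<^sup>2 < c\<^sup>2 - q z" using norm2[of z] by simp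
    moreover from this have "0 \<le> c\<^sup>2 - q z" using zero_le_power2[of "cmod (z $ i)"] by linarith
    moreover have "a\<^sup>2 < c\<^sup>2" "c\<^sup>2 < b\<^sup>2" using abc by (auto intro: power_strict_mono)
    ultimately show ?thesis unfolding N_def by (auto intro: real_less_rsqrt)
  qed
  have holG: "line_holomorphic_on G (ball 0 c)"
  proof (rule line_holomorphic_on_local)
    fix z :: "complex ^ 'n" assume "z \<in> ball 0 c"
    then show "\<exists>N' g'. open N' \<and> z \<in> N' \<and> line_holomorphic_on g' N' \<and> (\<forall>w\<in>N'. G w = g' w)"
      using adm by (intro exI[of _ "N (sqrt (c\<^sup>2 - q z)) \<inter> ball 0 c"]
          exI[of _ "\<lambda>w. contour_integral (circlepath 0 (sqrt (c\<^sup>2 - q z))) (H w)"])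
        (auto simp: G_def openN intro!: indep' intro: line_holomorphic_on_subset[OF hol])
  qed
  \<comment> \<open>When \<open>q z\<close> alone exceeds \<open>a\<^sup>2\<close>, the whole disc
    and not merely its boundary circle lies in the shell, and Cauchy's formula returns
    \<open>g\<close>.\<close>
  have eq: "G z = g z" if z: "norm z < c" "a\<^sup>2 < q z" for z
  proof -
    define \<rho> where "\<rho> = sqrt (c\<^sup>2 - q z)"
    have zN: "z \<in> N \<rho>" unfolding \<rho>_def by (rule adm[OF z(1)])
    have \<rho>: "\<rho>\<^sup>2 = c\<^sup>2 - q z" "0 < \<rho>"
    proof -
      show "0 < \<rho>" using zN unfolding N_def by (auto intro: le_less_trans[OF norm_ge_zero])
      then show "\<rho>\<^sup>2 = c\<^sup>2 - q z" unfolding \<rho>_def by simp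
    qed
    have "up z w \<in> U" if "cmod w \<le> \<rho>" for w
    proof (rule sh)
      have "(cmod w)\<^sup>2 \<le> \<rho>\<^sup>2" using that by (intro power_mono) auto
      moreover have "c\<^sup>2 < b\<^sup>2" using abc by (auto intro: power_strict_mono)
      ultimately show "(norm (up z w))\<^sup>2 < b\<^sup>2" by (simp add: norm_up \<rho>)
      show "a\<^sup>2 < (norm (up z w))\<^sup>2" using z by (simp add: norm_up add_strict_increasing2)
    qed
    then have "(\<lambda>w. g (up z w)) holomorphic_on cball 0 \<rho>"
      by (intro gup) auto
    from Cauchy_integral_circlepath_simple[OF this, of "z $ i"] zN
    have "((\<lambda>w. g (up z w) / (w - z $ i)) has_contour_integral 2 * of_real pi * \<i> * g (up z (z $ i))) (circlepath 0 \<rho>)"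
      by (simp add: N_def)
    from has_contour_integral_div[OF this, of "2 * of_real pi * \<i>"] show ?thesis
      unfolding G_def \<rho>_def[symmetric] H_def by (simp add: contour_integral_unique up_self)
  qed
  have "G z = g z" if "z \<in> U" "norm z < c" for z
  proof (rule line_holomorphic_identity[of "U \<inter> ball 0 c"])
    let ?W = "{z. norm z < c \<and> a\<^sup>2 < q z}"
    show "open ?W"
      by (intro open_Collect_conj open_Collect_less continuous_intros q_cont)
    show "?W \<subseteq> U \<inter> ball 0 c"
    proof
      fix z assume z: "z \<in> ?W"
      then have "a\<^sup>2 < (norm z)\<^sup>2" by (simp add: norm2 add_strict_increasing2)
      moreover have "(norm z)\<^sup>2 < b\<^sup>2" using z abc by (auto intro: power_strict_mono)
      ultimately show "z \<in> U \<inter> ball 0 c" using z sh by simp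
    qed
    \<comment> \<open>Here two dimensions are needed: a point on the axis
      \<open>k \<noteq> i\<close> puts all its norm into \<open>q\<close>, so the set
      \<open>?W\<close> from which the identity theorem starts is not empty.\<close>
    define y :: "complex ^ 'n" where "y = axis k (of_real ((a + c) / 2))"
    have "norm y = (a + c) / 2"
      using abc unfolding y_def norm_axis_complex norm_of_real by simp
    moreover have "q y = (norm y)\<^sup>2" using norm2[of y] k by (simp add: y_def axis_def)
    ultimately have "y \<in> ?W" using abc by (auto intro: power_strict_mono)
    then show "?W \<noteq> {}" by blast
  qed (use that U holG g eq in \<open>auto intro: line_holomorphic_on_subset\<close>)
  with holG that show thesis by blast
qed

section \<open>Self-maps of the ball with two fixed points\<close>

text \<open>Conjugation by the Moebius map \<open>M a\<close>, which sends \<open>a\<close> to 0,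
  gives a self-map \<open>k\<close> of the disc with \<open>k 0 = 0\<close> and a second fixed point
  \<open>b'\<close>. This is the equality case of the Schwarz lemma: \<open>k\<close> is a rotation,
  and fixing \<open>b'\<close> makes it the identity.\<close>

lemma disc_map_two_fixed_points:
  assumes hol: "g holomorphic_on ball 0 1" and le: "\<And>z. cmod z < 1 \<Longrightarrow> cmod (g z) \<le> 1"
    and ab: "cmod a < 1" "cmod b < 1" "a \<noteq> b" "g a = a" "g b = b" and z: "cmod z < 1"
  shows "g z = z"
proof -
  have not_const: "\<not> g constant_on ball 0 1"
    using ab unfolding constant_on_def by (metis dist_0_norm mem_ball)
  \<comment> \<open>\<open>g\<close> is only assumed to map into the closed disc. With two distinct
    fixed points it is not constant, so the maximum modulus principle keeps it off the unit
    circle.\<close>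
  have lt: "cmod (g w) < 1" if "cmod w < 1" for w
  proof (rule ccontr)
    assume "\<not> cmod (g w) < 1"
    then have "g constant_on ball 0 1"
      using that le by (intro maximum_modulus_principle[OF hol, where \<xi> = w and U = "ball 0 1"])
        (auto simp: not_less intro: order_trans)
    with not_const show False ..
  qed
  define M where "M = (\<lambda>w z. (z - w) / (1 - cnj w * z))"
  have M_nz: "1 - cnj w * z \<noteq> 0" if "cmod w < 1" "cmod z < 1" for w z
  proof
    assume "1 - cnj w * z = 0"
    then have "cmod (cnj w * z) = 1" by simp
    moreover have "cmod w * cmod z < 1 * 1" using that by (intro mult_strict_mono') auto
    ultimately show False by (simp add: norm_mult)
  qed
  have M_lt: "cmod (M w z) < 1" if "cmod w < 1" "cmod z < 1" for w z
  proof -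
    have "(cmod (1 - cnj w * z))\<^sup>2 - (cmod (z - w))\<^sup>2 = (1 - (cmod w)\<^sup>2) * (1 - (cmod z)\<^sup>2)"
      unfolding cmod_power2 by (simp add: power2_eq_square algebra_simps)
    moreover have "(1 - (cmod w)\<^sup>2) * (1 - (cmod z)\<^sup>2) > 0"
      using that by (intro mult_pos_pos) (simp_all add: abs_square_less_1)
    ultimately have "(cmod (z - w))\<^sup>2 < (cmod (1 - cnj w * z))\<^sup>2" by linarith
    then have "cmod (z - w) < cmod (1 - cnj w * z)" by (rule power_less_imp_less_base) simp
    then show ?thesis unfolding M_def norm_divide using M_nz[OF that] by simp
  qed
  have M_inv: "M (- w) (M w z) = z" if "cmod w < 1" "cmod z < 1" for w z
  proof -
    have 1: "1 - cnj w * z \<noteq> 0" "1 - cnj w * w \<noteq> 0" using M_nz that by auto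
    have "1 + cnj w * ((z - w) / (1 - cnj w * z)) = (1 - cnj w * w) / (1 - cnj w * z)"
      "(z - w) / (1 - cnj w * z) + w = z * (1 - cnj w * w) / (1 - cnj w * z)"
      using 1 by (simp_all add: field_simps)
    then show ?thesis unfolding M_def using 1 by simp
  qed
  have M_hol: "M w holomorphic_on ball 0 1" if "cmod w < 1" for w
    unfolding M_def using M_nz[OF that] by (intro holomorphic_intros) auto
  define k where "k = (\<lambda>z. M a (g (M (- a) z)))"
  have "(\<lambda>z. g (M (- a) z)) holomorphic_on ball 0 1"
    by (rule holomorphic_on_compose_gen[OF M_hol hol, unfolded o_def]) (use M_lt[of "- a"] ab in auto)
  moreover have "cmod (g (M (- a) z)) < 1" if "cmod z < 1" for z
    by (rule lt[OF M_lt]) (use ab that in auto)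
  then have "(\<lambda>z. g (M (- a) z)) ` ball 0 1 \<subseteq> ball 0 1" by auto
  ultimately have k_hol: "k holomorphic_on ball 0 1"
    unfolding k_def by (rule holomorphic_on_compose_gen[OF _ M_hol[OF ab(1)], unfolded o_def])
  define b' where "b' = M a b"
  have b': "cmod b' < 1" "b' \<noteq> 0" "k b' = b'"
    using M_lt[of a b] M_inv[of a b] M_nz[of a b] ab by (auto simp: b'_def k_def M_def)
  have "M (- a) 0 = a" "M a a = 0" by (auto simp: M_def)
  then have "k 0 = 0" using ab by (simp add: k_def)
  have "\<exists>\<alpha>. (\<forall>z. norm z < 1 \<longrightarrow> k z = \<alpha> * z) \<and> norm \<alpha> = 1"
    using b' M_lt lt ab by (intro Schwarz_Lemma(3)[OF k_hol \<open>k 0 = 0\<close> _ b'(1)]) (auto simp: k_def)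
  then obtain \<alpha> where \<alpha>: "\<And>z. norm z < 1 \<Longrightarrow> k z = \<alpha> * z" by blast
  from \<alpha>[OF b'(1)] b' have "\<alpha> = 1" by simp
  have "M (- a) (k (M a z)) = M (- a) (M a z)"
    using \<alpha>[OF M_lt[OF ab(1) z]] \<open>\<alpha> = 1\<close> by simp
  then show ?thesis
    using M_inv[of a z] M_inv[of a "g z"] lt[OF z] ab z by (simp add: k_def)
qed

section \<open>The Hermitian form and the discs cut from the ball by complex lines\<close>

definition hermitian :: "complex ^ 'n \<Rightarrow> complex ^ 'n \<Rightarrow> complex" where
  "hermitian z w = (\<Sum>i\<in>UNIV. z $ i * cnj (w $ i))"

lemma hermitian_add_left: "hermitian (x + y) w = hermitian x w + hermitian y w"
  and hermitian_diff_left: "hermitian (x - y) w = hermitian x w - hermitian y w"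
  and hermitian_scale_left: "hermitian (c *s x) w = c * hermitian x w"
  and hermitian_scale_right: "hermitian w (c *s x) = cnj c * hermitian w x"
  by (simp_all add: hermitian_def sum.distrib sum_subtractf sum_distrib_left algebra_simps)

lemma hermitian_commute: "hermitian w z = cnj (hermitian z w)"
  by (simp add: hermitian_def mult.commute)

lemma hermitian_self: "hermitian z z = of_real ((norm z)\<^sup>2)"
  by (simp add: hermitian_def norm_vec_def L2_set_def sum_nonneg complex_norm_square del: of_real_power)

lemma Re_hermitian: "Re (hermitian z w) = z \<bullet> w"
  by (simp add: hermitian_def inner_vec_def inner_complex_def)

lemma hermitian_cauchy_schwarz: "cmod (hermitian z w) \<le> norm z * norm w"
proof -
  have "cmod (hermitian z w) \<le> (\<Sum>i\<in>UNIV. norm (z $ i) * norm (w $ i))"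
    unfolding hermitian_def by (rule sum_norm_le) (simp add: norm_mult)
  also have "\<dots> \<le> norm z * norm w"
    unfolding norm_vec_def using L2_set_mult_ineq[of "\<lambda>i. norm (z $ i)" "\<lambda>i. norm (w $ i)" UNIV] by simp
  finally show ?thesis .
qed

lemma norm_slice:
  assumes "norm v = 1" "hermitian c v = 0"
  shows "(norm (c + \<zeta> *s v))\<^sup>2 = (norm c)\<^sup>2 + (cmod \<zeta>)\<^sup>2"
proof -
  have "orthogonal c (\<zeta> *s v)"
    using assms Re_hermitian[of c "\<zeta> *s v"] by (simp add: hermitian_scale_right orthogonal_def)
  then show ?thesis
    using assms by (simp add: norm_add_Pythagorean norm_vector_scalar)
qed

text \<open>Bessel's inequality for the orthogonal pair \<open>v\<close>, \<open>c\<close>,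
  multiplied by \<open>(norm c)\<^sup>2\<close> so that \<open>c = 0\<close> is no exception: remove
  from \<open>w\<close> its component along \<open>v\<close> and apply Cauchy-Schwarz to the rest
  and \<open>c\<close>.\<close>

lemma hermitian_bessel:
  assumes v: "norm v = 1" and c: "hermitian c v = 0"
  shows "(norm c)\<^sup>2 * (cmod (hermitian w v))\<^sup>2 + (cmod (hermitian w c))\<^sup>2 \<le> (norm c)\<^sup>2 * (norm w)\<^sup>2"
proof -
  define x where "x = hermitian w v"
  define u where "u = w - x *s v"
  have vv: "hermitian v v = 1" using v by (simp add: hermitian_self)
  have uv: "hermitian u v = 0" by (simp add: u_def hermitian_diff_left hermitian_scale_left vv x_def)
  have "hermitian w w = hermitian (u + x *s v) (u + x *s v)"
    by (simp add: u_def)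
  also have "\<dots> = hermitian u u + x * cnj x"
  proof -
    have "hermitian (u + x *s v) (u + x *s v) = hermitian u (u + x *s v) + x * hermitian v (u + x *s v)"
      by (simp add: hermitian_add_left hermitian_scale_left)
    also have "hermitian u (u + x *s v) = hermitian u u"
      using uv hermitian_commute[of u "u + x *s v"] hermitian_commute[of u v]
      by (simp add: hermitian_add_left hermitian_scale_left hermitian_self)
    also have "hermitian v (u + x *s v) = cnj x"
      using uv hermitian_commute[of v "u + x *s v"]
      by (simp add: hermitian_add_left hermitian_scale_left vv)
    finally show ?thesis .
  qed
  finally have "(norm w)\<^sup>2 = (norm u)\<^sup>2 + (cmod x)\<^sup>2"
    unfolding hermitian_self complex_norm_square[symmetric] of_real_add[symmetric] of_real_eq_iff .
  moreover have "hermitian w c = hermitian u c"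
    using c hermitian_commute[of v c] by (simp add: u_def hermitian_diff_left hermitian_scale_left)
  moreover have "(cmod (hermitian u c))\<^sup>2 \<le> (norm u * norm c)\<^sup>2"
    by (intro power_mono hermitian_cauchy_schwarz) simp
  ultimately show ?thesis unfolding x_def[symmetric]
    by (simp add: power_mult_distrib algebra_simps)
qed

text \<open>The linear fractional function \<open>R * hermitian w v / (1 - hermitian w c)\<close> maps the ball into the unit
  disc and restricts to the chart \<open>\<zeta> / R\<close> of the slice \<open>c + \<zeta> v\<close>.\<close>

lemma slice_retraction_bound:
  assumes v: "norm v = 1" and c: "hermitian c v = 0" "norm c < 1" and w: "norm w \<le> 1"
  shows "(1 - (norm c)\<^sup>2) * (cmod (hermitian w v))\<^sup>2 \<le> (cmod (1 - hermitian w c))\<^sup>2"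
    and "hermitian w c \<noteq> 1"
proof -
  define s where "s = (norm c)\<^sup>2"
  define A where "A = cmod (hermitian w c)"
  define X where "X = (cmod (hermitian w v))\<^sup>2"
  have s: "0 \<le> s" "s < 1" using c by (simp_all add: s_def abs_square_less_1)
  have w2: "(norm w)\<^sup>2 \<le> 1" using w by (simp add: power_le_one)
  have A1: "A < 1"
  proof -
    have "A \<le> norm w * norm c" unfolding A_def by (rule hermitian_cauchy_schwarz)
    also have "\<dots> \<le> 1 * norm c" using w by (intro mult_right_mono) auto
    finally show ?thesis using c by simp
  qed
  then show "hermitian w c \<noteq> 1" by (auto simp: A_def)
  have "s * X + A\<^sup>2 \<le> s * (norm w)\<^sup>2"
    using hermitian_bessel[OF v c(1), of w] by (simp add: s_def A_def X_def)
  also have "\<dots> \<le> s" using w2 s mult_left_mono[of _ 1 s] by simp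
  finally have bessel: "s * X + A\<^sup>2 \<le> s" .
  have "(1 - s) * X \<le> (1 - A)\<^sup>2"
  \<comment> \<open>After multiplication by \<open>s\<close> the two sides differ by at least the
    square \<open>(s - A)\<^sup>2\<close>. For \<open>s = 0\<close> this says nothing, and
    Cauchy-Schwarz takes its place.\<close>
  proof (cases "s = 0")
    case True
    then have "A = 0" using bessel by simp
    moreover have "cmod (hermitian w v) \<le> 1"
      using hermitian_cauchy_schwarz[of w v] v w by simp
    ultimately show ?thesis using True by (simp add: X_def power_le_one)
  next
    case False
    have "s * ((1 - s) * X) \<le> (1 - s) * (s - A\<^sup>2)"
      using mult_left_mono[of "s * X" "s - A\<^sup>2" "1 - s"] bessel s by (simp add: algebra_simps)
    also have "\<dots> = s * (1 - A)\<^sup>2 - (s - A)\<^sup>2"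
      by (simp add: power2_eq_square algebra_simps)
    also have "\<dots> \<le> s * (1 - A)\<^sup>2" by simp
    finally show ?thesis using False s by simp
  qed
  also have "\<dots> \<le> (cmod (1 - hermitian w c))\<^sup>2"
    using norm_triangle_ineq2[of 1 "hermitian w c"] A1 by (intro power_mono) (auto simp: A_def)
  finally show "(1 - (norm c)\<^sup>2) * (cmod (hermitian w v))\<^sup>2 \<le> (cmod (1 - hermitian w c))\<^sup>2"
    by (simp add: s_def X_def)
qed

text \<open>Once the retraction is the identity along the slice, the displacement is \<open>O(R\<^sup>2 - |\<zeta>|\<^sup>2)\<close>.\<close>

lemma slice_displacement_bound:
  assumes v: "norm v = 1" and c: "hermitian c v = 0" "norm c < 1" and w: "norm w \<le> 1"
    and R: "R\<^sup>2 = 1 - (norm c)\<^sup>2" and \<zeta>: "cmod \<zeta> < R"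
    and eq: "hermitian w v * R\<^sup>2 = \<zeta> * (1 - hermitian w c)"
  shows "(norm (w - (c + \<zeta> *s v)))\<^sup>2 \<le> (R\<^sup>2 - (cmod \<zeta>)\<^sup>2) * (4 / R\<^sup>2)"
proof -
  define \<alpha> where "\<alpha> = Re (hermitian w c)"
  define t where "t = (cmod \<zeta>)\<^sup>2"
  have "R > 0" using \<zeta> le_less_trans norm_ge_zero by blast
  have "t < R\<^sup>2" using \<zeta> by (simp add: t_def power_strict_mono)
  have "(norm (c + \<zeta> *s v))\<^sup>2 = (norm c)\<^sup>2 + t"
    using norm_slice[OF v c(1)] by (simp add: t_def)
  \<comment> \<open>\<open>eq\<close> expresses \<open>hermitian w v\<close> through
    \<open>hermitian w c\<close>, so only the real part \<alpha> of the latter remains.\<close>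
  moreover have "w \<bullet> (c + \<zeta> *s v) = \<alpha> + (t / R\<^sup>2) * (1 - \<alpha>)"
  proof -
    have x: "hermitian w v = \<zeta> * (1 - hermitian w c) / R\<^sup>2"
      using eq \<open>R > 0\<close> by (simp add: field_simps)
    have "w \<bullet> (\<zeta> *s v) = Re (cnj \<zeta> * hermitian w v)"
      by (simp add: Re_hermitian[symmetric] hermitian_scale_right)
    also have "cnj \<zeta> * hermitian w v = of_real (t / R\<^sup>2) * (1 - hermitian w c)"
      unfolding x t_def of_real_divide complex_norm_square by simp
    also have "Re \<dots> = (t / R\<^sup>2) * (1 - \<alpha>)" by (simp add: \<alpha>_def)
    finally show ?thesis by (simp add: inner_add_right \<alpha>_def Re_hermitian)
  qed
  ultimately have "(norm (w - (c + \<zeta> *s v)))\<^sup>2 = (norm w)\<^sup>2 + ((norm c)\<^sup>2 + t) - 2 * (\<alpha> + (t / R\<^sup>2) * (1 - \<alpha>))"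
    by (simp add: power2_norm_eq_inner inner_diff_left inner_diff_right inner_commute)
  also have "\<dots> \<le> 1 + ((norm c)\<^sup>2 + t) - 2 * (\<alpha> + (t / R\<^sup>2) * (1 - \<alpha>))"
    using w by (simp add: power_le_one)
  also have "\<dots> = (R\<^sup>2 - t) * (2 / R\<^sup>2 * (1 - \<alpha>) - 1)"
  proof -
    \<comment> \<open>This substitution makes the factor \<open>R\<^sup>2 - t\<close> split off,
      which is what vanishes at the boundary of the slice.\<close>
    have nc: "(norm c)\<^sup>2 = 1 - R\<^sup>2" using R by simp
    show ?thesis unfolding nc using \<open>R > 0\<close> by (simp add: field_simps)
  qed
  also have "\<dots> \<le> (R\<^sup>2 - t) * (4 / R\<^sup>2)"
  proof (intro mult_left_mono)
    have "\<bar>\<alpha>\<bar> \<le> norm w * norm c" unfolding \<alpha>_def using abs_Re_le_cmod hermitian_cauchy_schwarz order_trans by blast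
    also have "\<dots> \<le> 1 * 1" using w c by (intro mult_mono) auto
    finally have "2 / R\<^sup>2 * (1 - \<alpha>) \<le> 2 / R\<^sup>2 * 2" by (intro mult_left_mono) auto
    then show "2 / R\<^sup>2 * (1 - \<alpha>) - 1 \<le> 4 / R\<^sup>2" by simp
  qed (use \<open>t < R\<^sup>2\<close> in simp)
  finally show ?thesis by (simp add: t_def)
qed

text \<open>\<open>c\<close> is the foot of the perpendicular from the origin to the complex line,
  so by \<open>norm_slice\<close> the line cuts the ball in a round disc about \<open>c\<close>;
  \<open>d\<close> is the distance from \<open>p\<close> to \<open>q\<close>.\<close>

lemma slice_normal_form:
  fixes p q :: "complex ^ 'n"
  assumes "p \<noteq> q" "norm p < 1"
  obtains c v :: "complex ^ 'n" and x :: complex and d :: real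
  where "norm v = 1" "hermitian c v = 0" "norm c < 1" "d > 0"
    "\<And>\<zeta>. p + \<zeta> *s (q - p) = c + (x + \<zeta> * of_real d) *s v"
proof -
  define d where "d = norm (q - p)"
  define v where "v = of_real (1 / d) *s (q - p)"
  define x where "x = hermitian p v"
  define c where "c = p - x *s v"
  have d: "d > 0" using assms by (simp add: d_def)
  have v: "norm v = 1" unfolding v_def norm_vector_scalar d_def[symmetric] using d by (simp add: norm_divide)
  have vv: "hermitian v v = 1" using v by (simp add: hermitian_self)
  have cv: "hermitian c v = 0" by (simp add: c_def hermitian_diff_left hermitian_scale_left vv x_def)
  have line: "p + \<zeta> *s (q - p) = c + (x + \<zeta> * of_real d) *s v" for \<zeta>
    using d by (simp add: c_def v_def vec_eq_iff algebra_simps)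
  have p: "p = c + x *s v" using line[of 0] by simp
  have "(norm c)\<^sup>2 \<le> (norm p)\<^sup>2" unfolding p norm_slice[OF v cv] by simp
  then have "norm c < 1" using assms(2) by (meson le_less_trans norm_ge_zero power2_le_imp_le)
  with v cv d line that show thesis by blast
qed

text \<open>By the maximum principle, since the displacement tends to 0 at the boundary of the slice.\<close>

lemma ball_map_fixes_slice:
  fixes F :: "complex ^ 'n \<Rightarrow> complex ^ 'n"
  assumes hol: "\<And>i. line_holomorphic_on (\<lambda>z. F z $ i) (ball 0 1)"
    and le: "\<And>z. norm z < 1 \<Longrightarrow> norm (F z) \<le> 1"
    and pq: "norm p < 1" "norm q < 1" "p \<noteq> q" "F p = p" "F q = q"
    and z: "norm (p + \<zeta> *s (q - p)) < 1"
  shows "F (p + \<zeta> *s (q - p)) = p + \<zeta> *s (q - p)"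
proof -
  obtain c v x d where v: "norm v = 1" and cv: "hermitian c v = 0" and c: "norm c < 1" and d: "d > 0"
    and line: "\<And>\<zeta>. p + \<zeta> *s (q - p) = c + (x + \<zeta> * of_real d) *s v"
    using slice_normal_form[OF pq(3,1)] by metis
  define R where "R = sqrt (1 - (norm c)\<^sup>2)"
  have vv: "hermitian v v = 1" using v by (simp add: hermitian_self)
  have vc: "hermitian v c = 0" using cv hermitian_commute[of v c] by simp
  have p: "p = c + x *s v" and q: "q = c + (x + of_real d) *s v"
    using line[of 0] line[of 1] by simp_all
  note slice = norm_slice[OF v cv]
  have R: "R > 0" "R\<^sup>2 = 1 - (norm c)\<^sup>2"
    using c    by (simp_all add: R_def abs_square_less_1 less_imp_le)
  have in_ball: "norm (c + \<zeta> *s v) < 1 \<longleftrightarrow> cmod \<zeta> < R" for \<zeta>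
  proof -
    have "norm (c + \<zeta> *s v) < 1 \<longleftrightarrow> (norm (c + \<zeta> *s v))\<^sup>2 < 1"
      by (simp add: abs_square_less_1)
    also have "\<dots> \<longleftrightarrow> (cmod \<zeta>)\<^sup>2 < R\<^sup>2" by (auto simp: slice R)
    also have "\<dots> \<longleftrightarrow> cmod \<zeta> < R"
      using R(1) power2_less_imp_less[of "cmod \<zeta>" R] power_strict_mono[of "cmod \<zeta>" R 2] by auto
    finally show ?thesis .
  qed
  define h where "h = (\<lambda>\<zeta>. F (c + \<zeta> *s v))"
  have h_hol: "(\<lambda>\<zeta>. h \<zeta> $ i) holomorphic_on ball 0 R" for i
    unfolding h_def by (rule line_holomorphic_on_line[OF hol]) (simp add: in_ball)
  have h_le: "norm (h \<zeta>) \<le> 1" if "cmod \<zeta> < R" for \<zeta>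
    unfolding h_def using le in_ball that by blast
  \<comment> \<open>\<open>F\<close> on the slice followed by the retraction, in the chart that
    turns the slice into the unit disc. The points \<open>p\<close> and \<open>q\<close> become two
    fixed points of \<open>g\<close>.\<close>
  define g where "g = (\<lambda>\<zeta>. of_real R * hermitian (h (of_real R * \<zeta>)) v / (1 - hermitian (h (of_real R * \<zeta>)) c))"
  have scale: "cmod (of_real R * \<zeta>) < R" if "cmod \<zeta> < 1" for \<zeta>
    using that R by (simp add: norm_mult)
  have nz: "hermitian (h \<zeta>) c \<noteq> 1" if "cmod \<zeta> < R" for \<zeta>
    using slice_retraction_bound(2)[OF v cv c h_le[OF that]] .
  have g_id: "g \<zeta> = \<zeta>" if "cmod \<zeta> < 1" for \<zeta>
  proof (rule disc_map_two_fixed_points[OF _ _ _ _ _ _ _ that])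
    have "(\<lambda>\<zeta>. h (of_real R * \<zeta>) $ i) holomorphic_on ball 0 1" for i
      by (rule holomorphic_on_compose_gen[OF _ h_hol, of "\<lambda>\<zeta>. of_real R * \<zeta>", unfolded o_def])
        (use scale in \<open>auto intro!: holomorphic_intros\<close>)
    then show "g holomorphic_on ball 0 1"
      unfolding g_def hermitian_def
      by (intro holomorphic_intros) (use nz scale in \<open>auto simp: hermitian_def\<close>)
    show "cmod (g \<zeta>) \<le> 1" if "cmod \<zeta> < 1" for \<zeta>
    proof -
      let ?w = "h (of_real R * \<zeta>)"
      have "(R * cmod (hermitian ?w v))\<^sup>2 \<le> (cmod (1 - hermitian ?w c))\<^sup>2"
        using slice_retraction_bound(1)[OF v cv c h_le[OF scale[OF that]]] by (simp add: power_mult_distrib R)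
      then have "R * cmod (hermitian ?w v) \<le> cmod (1 - hermitian ?w c)"
        by (rule power2_le_imp_le) simp
      then show ?thesis
        using nz[OF scale[OF that]] R by (simp add: g_def norm_divide norm_mult divide_le_eq)
    qed
    have g_fix: "g (\<zeta> / of_real R) = \<zeta> / of_real R" if "h \<zeta> = c + \<zeta> *s v" for \<zeta>
    proof -
      have "hermitian (c + \<zeta> *s v) v = \<zeta>" "1 - hermitian (c + \<zeta> *s v) c = of_real (R\<^sup>2)"
        by (simp_all add: hermitian_add_left hermitian_scale_left vv cv vc R hermitian_self[of c])
      then show ?thesis using R that by (simp add: g_def power2_eq_square)
    qed
    show "g (x / of_real R) = x / of_real R" "g ((x + of_real d) / of_real R) = (x + of_real d) / of_real R"
      by (rule g_fix, unfold h_def p[symmetric] q[symmetric], rule pq)+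
    show "cmod (x / of_real R) < 1" "cmod ((x + of_real d) / of_real R) < 1"
      using pq(1,2) R unfolding p q in_ball by (simp_all add: norm_divide)
    show "x / of_real R \<noteq> (x + of_real d) / of_real R"
      using d R by (simp add: divide_simps)
  qed
  have "h \<zeta>\<^sub>0 $ i = (c + \<zeta>\<^sub>0 *s v) $ i" if \<zeta>\<^sub>0: "cmod \<zeta>\<^sub>0 < R" for \<zeta>\<^sub>0 i
  proof -
    define \<phi> where "\<phi> = (\<lambda>\<zeta>. h \<zeta> $ i - (c + \<zeta> *s v) $ i)"
    have \<phi>_hol: "\<phi> holomorphic_on ball 0 R"
      unfolding \<phi>_def by (auto intro!: holomorphic_intros h_hol)
    have \<phi>_le: "(cmod (\<phi> \<zeta>))\<^sup>2 \<le> (R\<^sup>2 - (cmod \<zeta>)\<^sup>2) * (4 / R\<^sup>2)" if "cmod \<zeta> < R" for \<zeta>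
    proof -
      have "cmod (\<zeta> / of_real R) < 1" using that R by (simp add: norm_divide)
      from g_id[OF this] have "of_real R * hermitian (h \<zeta>) v / (1 - hermitian (h \<zeta>) c) = \<zeta> / of_real R"
        using R by (simp add: g_def)
      then have eq: "hermitian (h \<zeta>) v * R\<^sup>2 = \<zeta> * (1 - hermitian (h \<zeta>) c)"
        using R nz[OF that] by (simp add: field_simps power2_eq_square)
      have "cmod (\<phi> \<zeta>) \<le> norm (h \<zeta> - (c + \<zeta> *s v))"
        unfolding \<phi>_def using Finite_Cartesian_Product.norm_nth_le[of "h \<zeta> - (c + \<zeta> *s v)" i] by simp
      then have "(cmod (\<phi> \<zeta>))\<^sup>2 \<le> (norm (h \<zeta> - (c + \<zeta> *s v)))\<^sup>2" by (intro power_mono) auto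
      with slice_displacement_bound[OF v cv c h_le[OF that] R(2) that eq] show ?thesis by linarith
    qed
    \<comment> \<open>\<open>\<phi>\<close> is not defined as a holomorphic function up to the
      circle of radius \<open>R\<close>, so the maximum principle is applied at radius
      \<open>r < R\<close>, and then \<open>r\<close> tends to \<open>R\<close>.\<close>
    have "(cmod (\<phi> \<zeta>\<^sub>0))\<^sup>2 \<le> (R\<^sup>2 - r\<^sup>2) * (4 / R\<^sup>2)" if r: "cmod \<zeta>\<^sub>0 < r" "r < R" for r
    proof -
      have "0 < r" using r le_less_trans norm_ge_zero by blast
      have "cmod (\<phi> \<zeta>\<^sub>0) \<le> sqrt ((R\<^sup>2 - r\<^sup>2) * (4 / R\<^sup>2))"
      proof (rule maximum_modulus_frontier[of \<phi> "cball 0 r"])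
        have "cball 0 r \<subseteq> ball (0::complex) R" using r by auto
        then have "\<phi> holomorphic_on cball 0 r" using \<phi>_hol holomorphic_on_subset by blast
        then show "\<phi> holomorphic_on interior (cball 0 r)" "continuous_on (closure (cball 0 r)) \<phi>"
          by (auto intro: holomorphic_on_imp_continuous_on holomorphic_on_subset)
        fix \<zeta> assume "\<zeta> \<in> frontier (cball (0::complex) r)"
        then have "cmod \<zeta> = r" using \<open>0 < r\<close> by simp
        then show "cmod (\<phi> \<zeta>) \<le> sqrt ((R\<^sup>2 - r\<^sup>2) * (4 / R\<^sup>2))"
          using \<phi>_le[of \<zeta>] r by (intro real_le_rsqrt) simp
      qed (use r in auto)
      then have "(cmod (\<phi> \<zeta>\<^sub>0))\<^sup>2 \<le> (sqrt ((R\<^sup>2 - r\<^sup>2) * (4 / R\<^sup>2)))\<^sup>2" by (intro power_mono) auto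
      moreover have "0 \<le> (R\<^sup>2 - r\<^sup>2) * (4 / R\<^sup>2)" using r \<open>0 < r\<close> by (simp add: power_mono)
      ultimately show ?thesis by simp
    qed
    then have "\<forall>\<^sub>F r in at_left R. (cmod (\<phi> \<zeta>\<^sub>0))\<^sup>2 \<le> (R\<^sup>2 - r\<^sup>2) * (4 / R\<^sup>2)"
      using \<zeta>\<^sub>0 eventually_at_left_field by blast
    moreover have "((\<lambda>r. (R\<^sup>2 - r\<^sup>2) * (4 / R\<^sup>2)) \<longlongrightarrow> (R\<^sup>2 - R\<^sup>2) * (4 / R\<^sup>2)) (at_left R)"
      by (intro tendsto_intros)
    ultimately have "(cmod (\<phi> \<zeta>\<^sub>0))\<^sup>2 \<le> (R\<^sup>2 - R\<^sup>2) * (4 / R\<^sup>2)"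
      by (intro tendsto_lowerbound[of "\<lambda>r. (R\<^sup>2 - r\<^sup>2) * (4 / R\<^sup>2)"]) auto
    then show ?thesis by (simp add: \<phi>_def)
  qed
  moreover have "cmod (x + \<zeta> * of_real d) < R"
    using z unfolding line in_ball .
  ultimately have "h (x + \<zeta> * of_real d) = c + (x + \<zeta> * of_real d) *s v"
    unfolding vec_eq_iff by blast
  then show ?thesis unfolding line h_def .
qed

section \<open>The walled ball\<close>

text \<open>Radii increasing to 1. The shells between \<open>rad (2 * j + 1)\<close> and
  \<open>rad (2 * j + 2)\<close> carry one wall each; those between \<open>rad (2 * m)\<close> and
  \<open>rad (2 * m + 1)\<close> stay free and serve the Hartogs extension.\<close>

definition rad :: "nat \<Rightarrow> real" where
  "rad k = 1 - 1 / (real k + 2)"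

lemma rad_less_iff [simp]: "rad k < rad l \<longleftrightarrow> k < l"
  by (simp add: rad_def field_simps)

lemma rad_less_1: "rad k < 1" and rad_pos: "0 < rad k"
  by (simp_all add: rad_def field_simps)

lemma rad_exceeds: assumes "x < 1" obtains m where "\<And>k. m \<le> k \<Longrightarrow> x < rad k"
proof -
  obtain m :: nat where m: "1 / (1 - x) < real m" using reals_Archimedean2 by blast
  show thesis
  proof
    fix k assume "m \<le> k"
    then have "1 / (1 - x) < real k + 2" using m by linarith
    with assms show "x < rad k" by (simp add: rad_def field_simps)
  qed
qed

text \<open>A repeated index is allowed and gives twice a coordinate. All these functionals take the
  same nonzero value on \<open>all_ones\<close>, so one direction is transversal to every wall; that
  they are sums is what \<open>coord_sum_separates\<close> relies on.\<close>

definition coord_sum :: "'n \<times> 'n \<Rightarrow> complex ^ 'n \<Rightarrow> complex" where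
  "coord_sum ik z = z $ fst ik + z $ snd ik"

lemma coord_sum_add: "coord_sum ik (z + w) = coord_sum ik z + coord_sum ik w"
  and coord_sum_diff: "coord_sum ik (z - w) = coord_sum ik z - coord_sum ik w"
  and coord_sum_scale: "coord_sum ik (c *s z) = c * coord_sum ik z"
  by (simp_all add: coord_sum_def algebra_simps)

lemma continuous_on_coord_sum [continuous_intros]:
  "continuous_on S f \<Longrightarrow> continuous_on S (\<lambda>x. coord_sum ik (f x))"
  unfolding coord_sum_def by (intro continuous_intros)

definition all_ones :: "complex ^ 'n" where
  "all_ones = (\<chi> i. 1)"

lemma coord_sum_all_ones: "coord_sum ik all_ones = 2"
  by (simp add: coord_sum_def all_ones_def)

lemma all_ones_nonzero: "all_ones \<noteq> 0"
  by (simp add: all_ones_def vec_eq_iff)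

text \<open>\<open>j\<close> encodes a pair whose second component is a dummy natural number.
  Dropping it makes every functional and level recur for arbitrarily large \<open>j\<close>;
  rational levels keep the index set countable.\<close>

definition wall_index :: "nat \<Rightarrow> ('n::finite \<times> 'n) \<times> rat" where
  "wall_index j = fst (from_nat j :: _ \<times> nat)"

lemma wall_index_recurs: "\<exists>j\<ge>m. wall_index j = x"
proof -
  have "inj (\<lambda>k::nat. to_nat (x, k))" by (auto intro!: injI)
  then have "infinite (range (\<lambda>k::nat. to_nat (x, k)))" by (rule range_inj_infinite)
  moreover have "range (\<lambda>k::nat. to_nat (x, k)) \<subseteq> {j. wall_index j = x}"
    by (auto simp: wall_index_def)
  ultimately have "infinite {j. wall_index j = x}" using infinite_super by blast
  then show ?thesis unfolding infinite_nat_iff_unbounded_le by blast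
qed

definition wall :: "nat \<Rightarrow> (complex ^ 'n) set" where
  "wall j = {z. rad (2 * j + 1) \<le> norm z \<and> norm z \<le> rad (2 * j + 2) \<and>
     (case wall_index j of (ik, t) \<Rightarrow> Re (coord_sum ik z) = of_rat t)}"

definition walled_ball :: "(complex ^ 'n) set" where
  "walled_ball = ball 0 1 - (\<Union>j. wall j)"

lemma mem_wall_iff:
  "wall_index j = (ik, t) \<Longrightarrow> z \<in> wall j \<longleftrightarrow>
     rad (2 * j + 1) \<le> norm z \<and> norm z \<le> rad (2 * j + 2) \<and> Re (coord_sum ik z) = of_rat t"
  by (simp add: wall_def)

lemma norm_mem_wall:
  assumes "z \<in> wall j"
  shows "rad (2 * j + 1) \<le> norm z" "norm z \<le> rad (2 * j + 2)"
  using assms by (simp_all add: wall_def)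

lemma closed_wall: "closed (wall j)"
  unfolding wall_def case_prod_unfold
  by (intro closed_Collect_conj closed_Collect_le closed_Collect_eq continuous_intros)

text \<open>This range extends the \<open>m\<close>-th walled shell by the free shells on both of
  its sides, so no wall with \<open>j \<noteq> m\<close> can meet it.\<close>

lemma walled_ball_shell:
  assumes "rad (2 * m) < norm z" "norm z < rad (2 * m + 3)" "z \<notin> wall m"
  shows "z \<in> walled_ball"
proof -
  have "z \<notin> wall j" for j
  proof
    assume z: "z \<in> wall j"
    then have "rad (2 * m) < rad (2 * j + 2)" "rad (2 * j + 1) < rad (2 * m + 3)"
      using assms norm_mem_wall[OF z] by linarith+
    then have "j = m" by simp
    with z assms show False by simp
  qed
  moreover have "norm z < 1" using assms rad_less_1 less_trans by blast
  ultimately show ?thesis by (simp add: walled_ball_def)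
qed

lemma free_shell:
  assumes "rad (2 * m) < norm z" "norm z < rad (2 * m + 1)"
  shows "z \<in> walled_ball"
proof (rule walled_ball_shell)
  have "rad (2 * m + 1) < rad (2 * m + 3)" by simp
  then show "norm z < rad (2 * m + 3)" using assms by linarith
  show "z \<notin> wall m" using assms norm_mem_wall(1) by fastforce
qed (use assms in auto)

lemma small_ball_walled_ball: "norm z < rad 1 \<Longrightarrow> z \<in> walled_ball"
proof -
  assume z: "norm z < rad 1"
  have "z \<notin> wall j" for j
  proof
    assume "z \<in> wall j"
    then have "rad (2 * j + 1) < rad 1" using z norm_mem_wall(1) le_less_trans by blast
    then show False by simp
  qed
  moreover have "norm z < 1" using z rad_less_1 less_trans by blast
  ultimately show ?thesis by (simp add: walled_ball_def)
qed

lemma walled_ball_exhaustion: "walled_ball = (\<Union>m. walled_ball \<inter> ball 0 (rad (2 * m + 1)))"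
proof -
  have "\<exists>m. z \<in> ball 0 (rad (2 * m + 1))" if z: "z \<in> walled_ball" for z
  proof -
    have "norm z < 1" using z by (simp add: walled_ball_def)
    then obtain m where "\<And>k. m \<le> k \<Longrightarrow> norm z < rad k" using rad_exceeds by blast
    then have "norm z < rad (2 * m + 1)" by simp
    then show ?thesis by auto
  qed
  then show ?thesis by blast
qed

text \<open>The walls accumulate only at the unit sphere: the ball of radius
  \<open>rad (2 * m + 1)\<close> meets none but those with \<open>j < m\<close>, and a finite union
  of closed walls is closed.\<close>

lemma open_walled_ball: "open walled_ball"
proof -
  have "open (walled_ball \<inter> ball 0 (rad (2 * m + 1)))" for m
  proof -
    have "walled_ball \<inter> ball 0 (rad (2 * m + 1)) = ball 0 (rad (2 * m + 1)) - (\<Union>j<m. wall j)"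
    proof (intro equalityI subsetI)
      fix z assume z: "z \<in> ball 0 (rad (2 * m + 1)) - (\<Union>j<m. wall j)"
      have "z \<notin> wall j" for j
      proof
        assume j: "z \<in> wall j"
        have "norm z < rad (2 * m + 1)" using z by simp
        from le_less_trans[OF norm_mem_wall(1)[OF j] this] have "rad (2 * j + 1) < rad (2 * m + 1)" .
        then have "j < m" by simp
        with j z show False by blast
      qed
      moreover have "norm z < 1" using z rad_less_1[of "2 * m + 1"] by auto
      ultimately show "z \<in> walled_ball \<inter> ball 0 (rad (2 * m + 1))" using z by (auto simp: walled_ball_def)
    qed (auto simp: walled_ball_def)
    moreover have "closed (\<Union>j<m. wall j)" by (intro closed_UN closed_wall ballI) simp
    ultimately show ?thesis by (metis open_Diff open_ball)
  qed
  then show ?thesis by (subst walled_ball_exhaustion) (rule open_UN, blast)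
qed

text \<open>All walls are transversal to the real direction of \<open>all_ones\<close>, and countably many walls cannot fill
  an interval of it.\<close>

lemma islimpt_walled_ball:
  fixes z :: "complex ^ 'n"
  assumes "norm z < 1"
  shows "z islimpt walled_ball"
  unfolding islimpt_approachable
proof (intro allI impI)
  fix e :: real assume "e > 0"
  define N where "N = norm (all_ones :: complex ^ 'n)"
  have "N > 0" using all_ones_nonzero by (simp add: N_def)
  define d where "d = min e (1 - norm z) / N"
  have "d > 0" using \<open>e > 0\<close> assms \<open>N > 0\<close> by (simp add: d_def)
  \<comment> \<open>The parameters \<open>s\<close> at which the moved point meets the hyperplane of
    some wall, one for each wall; the divisor 2 is \<open>coord_sum_all_ones\<close>.\<close>
  define B where "B = range (\<lambda>j. case wall_index j of (ik, t) \<Rightarrow> (of_rat t - Re (coord_sum ik z)) / 2)"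
  have "countable B" unfolding B_def by simp
  moreover have "uncountable {0<..<d}" using \<open>d > 0\<close> by (simp add: uncountable_open_interval)
  ultimately obtain s where s: "0 < s" "s < d" "s \<notin> B"
    by (meson countable_subset greaterThanLessThan_iff subsetI)
  define w where "w = z + of_real s *s all_ones"
  have n: "norm (of_real s *s all_ones :: complex ^ 'n) < min e (1 - norm z)"
    using s \<open>N > 0\<close> unfolding norm_vector_scalar N_def[symmetric] by (simp add: d_def field_simps)
  have "norm w < 1" using n norm_triangle_ineq[of z "of_real s *s all_ones"] by (simp add: w_def)
  moreover have "w \<notin> wall j" for j
  proof
    assume w: "w \<in> wall j"
    obtain ik t where j: "wall_index j = (ik :: 'n \<times> 'n, t)" by (metis surj_pair)
    have "s = (of_rat t - Re (coord_sum ik z)) / 2"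
      using w by (simp add: mem_wall_iff[OF j] w_def coord_sum_add coord_sum_scale coord_sum_all_ones)
    then have "s \<in> B" unfolding B_def by (rule range_eqI[of _ _ j, OF trans]) (simp add: j)
    with s show False by blast
  qed
  ultimately have "w \<in> walled_ball" by (simp add: walled_ball_def)
  moreover have "w \<noteq> z" using s all_ones_nonzero by (simp add: w_def vec_eq_iff all_ones_def)
  moreover have "dist w z < e" using n by (simp add: w_def dist_norm)
  ultimately show "\<exists>x'\<in>walled_ball. x' \<noteq> z \<and> dist x' z < e" by blast
qed

section \<open>Connectedness of the walled ball\<close>

lemma connected_spherical_shell:
  assumes "0 \<le> r"
  shows "connected {w :: complex ^ 'n. r < norm w \<and> norm w < s}"
proof -
  have "{w :: complex ^ 'n. r < norm w \<and> norm w < s} = (\<lambda>(t, x). t *\<^sub>R x) ` ({r<..<s} \<times> sphere 0 1)"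
  proof (intro equalityI subsetI)
    fix w :: "complex ^ 'n" assume "w \<in> {w. r < norm w \<and> norm w < s}"
    with assms show "w \<in> (\<lambda>(t, x). t *\<^sub>R x) ` ({r<..<s} \<times> sphere 0 1)"
      by (intro image_eqI[of _ _ "(norm w, (1 / norm w) *\<^sub>R w)"]) auto
  qed (use assms in auto)
  \<comment> \<open>The real dimension is twice \<open>CARD('n)\<close>, so the unit sphere is
    connected even for \<open>n = 1\<close>.\<close>
  moreover have "2 \<le> DIM(complex ^ 'n)" using zero_less_card_finite[where 'a = 'n] by simp
  then have "connected ({r<..<s} \<times> sphere (0 :: complex ^ 'n) 1)"
    by (intro connected_Times connected_sphere) auto
  ultimately show ?thesis
    by (simp add: connected_continuous_image case_prod_unfold continuous_intros)
qed

lemma connected_by_hub: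
  assumes "connected S" "S \<subseteq> X" and T: "\<And>z. z \<in> X \<Longrightarrow> \<exists>T. connected T \<and> T \<subseteq> X \<and> z \<in> T \<and> T \<inter> S \<noteq> {}"
  shows "connected X"
  unfolding connected_iff_connected_component
proof (intro ballI)
  have *: "\<exists>s\<in>S. connected_component X z s" if "z \<in> X" for z
    using T[OF that] unfolding connected_component_def by blast
  fix x y assume "x \<in> X" "y \<in> X"
  then obtain s t where "s \<in> S" "connected_component X x s" "t \<in> S" "connected_component X y t"
    using * by blast
  moreover have "connected_component X s t"
    using assms \<open>s \<in> S\<close> \<open>t \<in> S\<close> unfolding connected_component_def by blast
  ultimately show "connected_component X x y"
    using connected_component_trans connected_component_sym by blast
qed

text \<open>Every wall is invariant under imaginary multiples of \<open>all_ones\<close>, so a point off the wall of its shell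
  can leave the shell outwards.\<close>

lemma escape_shell:
  fixes z :: "complex ^ 'n"
  assumes z: "rad (2 * m) < norm z" "norm z \<le> rad (2 * m + 2)"
      "wall_index m = (ik, t)" "Re (coord_sum ik z) \<noteq> of_rat t"
    and \<rho>: "rad (2 * m + 2) < \<rho>" "\<rho> \<le> rad (2 * m + 3)"
  obtains T where "connected T" "T \<subseteq> walled_ball \<inter> ball 0 \<rho>" "z \<in> T"
    "T \<inter> {w. rad (2 * m + 2) < norm w \<and> norm w < \<rho>} \<noteq> {}"
proof -
  \<comment> \<open>Adding imaginary multiples of \<open>all_ones\<close> leaves the real part of
    every \<open>coord_sum\<close> unchanged. The sign is chosen so that
    \<open>z \<bullet> u \<ge> 0\<close>, whence the norm does not decrease along the ray.\<close>
  define u :: "complex ^ 'n" where "u = (if z \<bullet> (\<i> *s all_ones) \<ge> 0 then \<i> else - \<i>) *s all_ones"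
  have "(- \<i>) *s all_ones = - (\<i> *s (all_ones :: complex ^ 'n))" by (simp add: vec_eq_iff)
  then have zu: "z \<bullet> u \<ge> 0" by (simp add: u_def)
  have u0: "norm u > 0" using all_ones_nonzero by (simp add: u_def norm_vector_scalar)
  define \<gamma> where "\<gamma> = (\<lambda>s. z + s *\<^sub>R u)"
  have re: "Re (coord_sum ik (\<gamma> s)) = Re (coord_sum ik z)" for ik s
    by (simp add: \<gamma>_def u_def coord_sum_def all_ones_def)
  have n2: "(norm (\<gamma> s))\<^sup>2 = (norm z)\<^sup>2 + 2 * s * (z \<bullet> u) + s\<^sup>2 * (norm u)\<^sup>2" for s
    unfolding \<gamma>_def power2_norm_eq_inner by (simp add: inner_add_left inner_add_right inner_commute power2_eq_square)
  have mono: "norm (\<gamma> s) \<le> norm (\<gamma> t)" if "0 \<le> s" "s \<le> t" for s t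
  proof (rule power2_le_imp_le)
    show "(norm (\<gamma> s))\<^sup>2 \<le> (norm (\<gamma> t))\<^sup>2"
      unfolding n2 using that zu by (intro add_mono mult_right_mono mult_left_mono power_mono) auto
  qed simp
  have cont: "continuous_on S \<gamma>" for S unfolding \<gamma>_def by (intro continuous_intros)
  define M where "M = (rad (2 * m + 2) + \<rho>) / 2"
  have M: "rad (2 * m + 2) < M" "M < \<rho>" using \<rho> by (auto simp: M_def)
  \<comment> \<open>\<open>M\<close> lies in the free shell just outside. At the parameter
    \<open>2 * M / norm u\<close> the displacement has norm \<open>2 * M\<close> while
    \<open>norm z \<le> M\<close>, so radius \<open>M\<close> has been reached by then.\<close>
  have "\<exists>s. 0 \<le> s \<and> s \<le> 2 * M / norm u \<and> norm (\<gamma> s) = M"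
  proof (rule IVT')
    have "0 < M" using M rad_pos less_trans by blast
    then have "M * 2 = norm ((2 * M / norm u) *\<^sub>R u)" using u0 by simp
    also have "\<dots> \<le> norm (\<gamma> (2 * M / norm u)) + norm z"
      unfolding \<gamma>_def using norm_triangle_ineq4[of "z + (2 * M / norm u) *\<^sub>R u" z] by simp
    finally show "M \<le> norm (\<gamma> (2 * M / norm u))" using z M by linarith
    show "0 \<le> 2 * M / norm u" using \<open>0 < M\<close> u0 by simp
    show "norm (\<gamma> 0) \<le> M" using z M by (simp add: \<gamma>_def)
  qed (intro continuous_intros cont)
  then obtain s where s: "0 \<le> s" "norm (\<gamma> s) = M" by blast
  show thesis
  proof
    show "connected (\<gamma> ` {0..s})" by (intro connected_continuous_image cont) simp
    show "z \<in> \<gamma> ` {0..s}" using s by (auto simp: \<gamma>_def image_iff intro!: bexI[of _ 0])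
    show "\<gamma> ` {0..s} \<inter> {w. rad (2 * m + 2) < norm w \<and> norm w < \<rho>} \<noteq> {}"
    proof -
      have "\<gamma> s \<in> \<gamma> ` {0..s}" using s by simp
      with s M show ?thesis by blast
    qed
    show "\<gamma> ` {0..s} \<subseteq> walled_ball \<inter> ball 0 \<rho>"
    proof clarify
      fix t assume t: "t \<in> {0..s}"
      have "norm z \<le> norm (\<gamma> t)" using mono[of 0 t] t by (simp add: \<gamma>_def)
      moreover have "norm (\<gamma> t) \<le> M" using mono[of t s] t s by simp
      ultimately show "\<gamma> t \<in> walled_ball \<inter> ball 0 \<rho>"
        using z \<rho> M by (auto intro!: walled_ball_shell[of m] simp: mem_wall_iff[OF z(3)] re)
    qed
  qed
qed

text \<open>Induction over the walled shells, the hub being the free shell just outside the last of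
  them. Points beside the wall escape to it one by one; the part inside is connected by induction,
  so a single escaping path joins all of it.\<close>

lemma connected_walled_ball_Int_ball:
  fixes \<rho> :: real
  assumes "rad (2 * m) < \<rho>" "\<rho> \<le> rad (2 * m + 1)"
  shows "connected (walled_ball \<inter> ball (0 :: complex ^ 'n) \<rho>)"
  using assms
proof (induction m arbitrary: \<rho>)
  case 0
  then have "walled_ball \<inter> ball 0 \<rho> = ball (0 :: complex ^ 'n) \<rho>"
    by (auto intro!: small_ball_walled_ball)
  then show ?case by simp
next
  case (Suc m)
  then have \<rho>: "rad (2 * m + 2) < \<rho>" "\<rho> \<le> rad (2 * m + 3)" by (simp_all add: eval_nat_numeral)
  let ?S = "{w :: complex ^ 'n. rad (2 * m + 2) < norm w \<and> norm w < \<rho>}"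
  show ?case
  proof (rule connected_by_hub)
    show "connected ?S" using connected_spherical_shell rad_pos less_imp_le by blast
    show "?S \<subseteq> walled_ball \<inter> ball 0 \<rho>"
    proof
      fix w assume "w \<in> ?S"
      moreover from this have "w \<in> walled_ball"
        using Suc.prems \<rho> by (intro free_shell[of "Suc m"]) auto
      ultimately show "w \<in> walled_ball \<inter> ball 0 \<rho>" by simp
    qed
    fix z :: "complex ^ 'n" assume z: "z \<in> walled_ball \<inter> ball 0 \<rho>"
    obtain ik t where ikt: "wall_index m = (ik :: 'n \<times> 'n, t)" by (metis surj_pair)
    consider "norm z < rad (2 * m + 1)" | "rad (2 * m + 1) \<le> norm z" "norm z \<le> rad (2 * m + 2)"
      | "rad (2 * m + 2) < norm z" by linarith
    then show "\<exists>T. connected T \<and> T \<subseteq> walled_ball \<inter> ball 0 \<rho> \<and> z \<in> T \<and> T \<inter> ?S \<noteq> {}"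
    proof cases
      case 1
      define i where "i = fst ik"
      define w :: "real \<Rightarrow> complex ^ 'n" where "w = (\<lambda>s. of_real s *s axis i 1)"
      have norm_w: "norm (w s) = \<bar>s\<bar>" for s
        unfolding w_def norm_vector_scalar norm_axis_complex by simp
      \<comment> \<open>Two trial radii in the free shell below the wall. On the axis
        \<open>i\<close> the real part of \<open>coord_sum ik\<close> is a positive multiple of the
        radius, so at most one of them gives the value \<open>t\<close>.\<close>
      define s1 s2 where "s1 = (2 * rad (2 * m) + rad (2 * m + 1)) / 3" and "s2 = (rad (2 * m) + 2 * rad (2 * m + 1)) / 3"
      have "rad (2 * m) < rad (2 * m + 1)" by simp
      then have ss: "s1 < s2" "rad (2 * m) < s1" "s1 < rad (2 * m + 1)" "rad (2 * m) < s2" "s2 < rad (2 * m + 1)"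
        unfolding s1_def s2_def by simp_all
      have c: "coord_sum ik (w s) = of_real s * coord_sum ik (axis i 1)" for s
        by (simp add: w_def coord_sum_scale)
      have "Re (coord_sum ik (axis i 1 :: complex ^ 'n)) > 0"
        by (simp add: coord_sum_def i_def axis_def)
      then have "Re (coord_sum ik (w s1)) \<noteq> Re (coord_sum ik (w s2))"
        using ss by (simp add: c)
      then obtain s where s: "rad (2 * m) < s" "s < rad (2 * m + 1)"
        "Re (coord_sum ik (w s)) \<noteq> of_rat t"
        using ss by metis
      then have "s > 0" using rad_pos[of "2 * m"] by simp
      have up: "rad (2 * m + 1) < rad (2 * m + 2)" by simp
      have "norm (w s) \<le> rad (2 * m + 2)" using s(2) up \<open>s > 0\<close> unfolding norm_w by linarith
      then obtain T where T: "connected T" "T \<subseteq> walled_ball \<inter> ball 0 \<rho>" "w s \<in> T" "T \<inter> ?S \<noteq> {}"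
        using escape_shell[of m "w s" ik t \<rho>] ikt s \<rho> \<open>s > 0\<close> by (auto simp: norm_w)
      let ?B = "walled_ball \<inter> ball (0 :: complex ^ 'n) (rad (2 * m + 1))"
      have "w s \<in> ?B" using s \<open>s > 0\<close> free_shell[of m "w s"] by (auto simp: norm_w)
      then have "connected (?B \<union> T)"
        using T Suc.IH[of "rad (2 * m + 1)"] by (intro connected_Un) auto
      moreover have "?B \<subseteq> walled_ball \<inter> ball 0 \<rho>"
        using \<rho>(1) up by (intro Int_mono subset_ball order_refl) linarith
      ultimately show ?thesis using T z 1 by (intro exI[of _ "?B \<union> T"]) auto
    next
      case 2
      have "z \<notin> wall m" using z unfolding walled_ball_def by blast
      then have re: "Re (coord_sum ik z) \<noteq> of_rat t"
        using 2 mem_wall_iff[OF ikt, of z] by blast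
      have "rad (2 * m) < rad (2 * m + 1)" by simp
      then have "rad (2 * m) < norm z" using 2 by linarith
      from escape_shell[OF this 2(2) ikt re \<rho>] obtain T
        where "connected T" "T \<subseteq> walled_ball \<inter> ball 0 \<rho>" "z \<in> T" "T \<inter> ?S \<noteq> {}" .
      then show ?thesis by (intro exI[of _ T] conjI)
    next
      case 3
      then show ?thesis using z by (intro exI[of _ "{z}"]) auto
    qed
  qed
qed

lemma connected_walled_ball: "connected (walled_ball :: (complex ^ 'n) set)"
proof -
  have "0 \<in> walled_ball \<inter> ball (0 :: complex ^ 'n) (rad (2 * m + 1))" for m
    using small_ball_walled_ball[of 0] rad_pos by auto
  then have "(\<Inter>m. walled_ball \<inter> ball (0 :: complex ^ 'n) (rad (2 * m + 1))) \<noteq> {}" by blast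
  then have "connected (\<Union>m. walled_ball \<inter> ball (0 :: complex ^ 'n) (rad (2 * m + 1)))"
    by (intro connected_Union) (auto intro!: connected_walled_ball_Int_ball)
  then show ?thesis using walled_ball_exhaustion by metis
qed

section \<open>Self-maps of the walled ball\<close>

lemma line_holomorphic_on_coord_sum:
  assumes "\<And>i. line_holomorphic_on (\<lambda>z. F z $ i) U"
  shows "line_holomorphic_on (\<lambda>z. coord_sum ik (F z)) U"
  using assms unfolding line_holomorphic_on_def coord_sum_def
  by (auto intro!: continuous_on_add field_differentiable_add)

lemma line_holomorphic_on_coord_sum_id: "line_holomorphic_on (coord_sum ik) U"
  unfolding line_holomorphic_on_def coord_sum_add coord_sum_scale
  by (auto intro!: continuous_intros derivative_intros)

text \<open>Each free shell yields an extension to a ball whose bounding sphere runs through its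
  middle, and these balls exhaust the unit ball.\<close>

lemma walled_ball_extension:
  fixes g :: "complex ^ 'n \<Rightarrow> complex"
  assumes card: "CARD('n) \<ge> 2" and g: "line_holomorphic_on g walled_ball"
  obtains G where "line_holomorphic_on G (ball 0 1)" "\<And>z. z \<in> walled_ball \<Longrightarrow> G z = g z"
proof -
  define c where "c = (\<lambda>m. (rad (2 * m) + rad (2 * m + 1)) / 2)"
  have c: "rad (2 * m) < c m" "c m < rad (2 * m + 1)" for m
    using rad_less_iff[of "2 * m" "2 * m + 1"] by (simp_all add: c_def)
  have "\<exists>G. line_holomorphic_on G (ball 0 (c m)) \<and> (\<forall>z\<in>walled_ball. norm z < c m \<longrightarrow> G z = g z)" for m
  proof -
    obtain G where "line_holomorphic_on G (ball 0 (c m))" "\<And>z. z \<in> walled_ball \<Longrightarrow> norm z < c m \<Longrightarrow> G z = g z"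
    proof (rule spherical_shell_extension[OF card _ c open_walled_ball _ _ g])
      show "connected (walled_ball \<inter> ball (0 :: complex ^ 'n) (c m))"
        using c[of m] by (intro connected_walled_ball_Int_ball) auto
    qed (use rad_pos free_shell in \<open>auto simp: less_imp_le\<close>)
    then show ?thesis by blast
  qed
  then obtain Gm where Gm: "\<And>m. line_holomorphic_on (Gm m) (ball 0 (c m))"
    "\<And>m z. z \<in> walled_ball \<Longrightarrow> norm z < c m \<Longrightarrow> Gm m z = g z" by metis
  \<comment> \<open>Taking the limit along the dense set \<open>walled_ball\<close> gives a value
    independent of \<open>m\<close>, so the functions \<open>Gm m\<close> need not be compared with
    each other.\<close>
  define G where "G = (\<lambda>z. Lim (at z within walled_ball) g)"
  have G_eq: "G z = Gm m z" if z: "norm z < c m" for m z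
    unfolding G_def
  proof (rule tendsto_Lim)
    have "norm z < 1" using z c[of m] rad_less_1[of "2 * m + 1"] by linarith
    then show "at z within walled_ball \<noteq> bot"
      using islimpt_walled_ball by (simp add: trivial_limit_within)
    have "continuous_on (ball 0 (c m)) (Gm m)" using Gm(1) unfolding line_holomorphic_on_def by blast
    then have "(Gm m \<longlongrightarrow> Gm m z) (at z)"
      using z by (simp add: continuous_on_eq_continuous_at isCont_def)
    then have "(Gm m \<longlongrightarrow> Gm m z) (at z within walled_ball)"
      by (rule tendsto_within_subset) simp
    moreover have "eventually (\<lambda>w. Gm m w = g w) (at z within walled_ball)"
      unfolding eventually_at_topological
      by (rule exI[of _ "ball 0 (c m)"]) (use z Gm(2) in auto)
    ultimately show "(g \<longlongrightarrow> Gm m z) (at z within walled_ball)"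
      using tendsto_cong by blast
  qed
  have ex: "\<exists>m. norm z < c m" if z: "norm z < 1" for z :: "complex ^ 'n"
  proof -
    obtain m where "\<And>k. m \<le> k \<Longrightarrow> norm z < rad k" using rad_exceeds[OF z] by blast
    then have "norm z < rad (2 * m)" by simp
    with c[of m] show ?thesis using less_trans by blast
  qed
  show thesis
  proof
    show "line_holomorphic_on G (ball 0 1)"
    proof (rule line_holomorphic_on_local)
      fix z :: "complex ^ 'n" assume "z \<in> ball 0 1"
      then obtain m where "norm z < c m" using ex by auto
      then show "\<exists>N g'. open N \<and> z \<in> N \<and> line_holomorphic_on g' N \<and> (\<forall>w\<in>N. G w = g' w)"
        using G_eq Gm(1) by (intro exI[of _ "ball 0 (c m)"] exI[of _ "Gm m"]) auto
    qed
    fix z :: "complex ^ 'n" assume z: "z \<in> walled_ball"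
    then obtain m where "norm z < c m" using ex[of z] by (auto simp: walled_ball_def)
    then show "G z = g z" using G_eq Gm(2) z by simp
  qed
qed

section \<open>Rigidity at a wall\<close>

lemma holomorphic_Re_constant:
  assumes "open S" "connected S" "f holomorphic_on S" "\<And>\<zeta>. \<zeta> \<in> S \<Longrightarrow> Re (f \<zeta>) = t" "a \<in> S" "b \<in> S"
  shows "f a = f b"
proof -
  have "f constant_on S"
  proof (rule ccontr)
    assume nc: "\<not> f constant_on S"
    \<comment> \<open>An open image does not fit into the vertical line
      \<open>Re = t\<close>.\<close>
    have "open (f ` S)"
      by (rule open_mapping_thm[OF assms(3,1,2,1) order_refl nc])
    then obtain e where e: "e > 0" "ball (f a) e \<subseteq> f ` S"
      using \<open>a \<in> S\<close> open_contains_ball by blast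
    have "f a + of_real (e / 2) \<in> ball (f a) e" using e by (simp add: dist_norm)
    then obtain \<zeta> where "\<zeta> \<in> S" "f a + of_real (e / 2) = f \<zeta>" using e by blast
    then have "Re (f a) + e / 2 = Re (f \<zeta>)" by (metis Re_complex_of_real plus_complex.sel(1))
    with assms(4) \<open>\<zeta> \<in> S\<close> \<open>a \<in> S\<close> e show False by simp
  qed
  then show ?thesis using assms unfolding constant_on_def by metis
qed

text \<open>Near the crossing point \<open>k\<close> the map cannot cross the wall, so it preserves the two sides of the wall
  and hence the wall, which is foliated by the complex leaves \<open>coord_sum ik = const\<close>. On a leaf
  \<open>coord_sum ik \<circ> F\<close> has constant real part; its value is read off on the pointwise fixed line.\<close>

lemma wall_crossing:
  fixes F :: "complex ^ 'n \<Rightarrow> complex ^ 'n"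
  assumes hol: "\<And>i. line_holomorphic_on (\<lambda>z. F z $ i) (ball 0 1)"
    and maps: "\<And>z. z \<in> walled_ball \<Longrightarrow> F z \<in> walled_ball"
    and v: "coord_sum ik v \<noteq> 0"
    and line: "\<And>\<zeta>. norm (k + \<zeta> *s v) < 1 \<Longrightarrow> F (k + \<zeta> *s v) = k + \<zeta> *s v"
    and j: "wall_index j = (ik, t)" "rad (2 * j + 1) < norm k" "norm k < rad (2 * j + 2)"
    and k: "Re (coord_sum ik k) = of_rat t"
    and z: "norm z < 1"
  shows "coord_sum ik (F z) = coord_sum ik z"
proof -
  define \<mu> where "\<mu> = coord_sum ik v"
  define Sh where "Sh = {z :: complex ^ 'n. rad (2 * j + 1) < norm z \<and> norm z < rad (2 * j + 2)}"
  have "open Sh" unfolding Sh_def by (intro open_Collect_conj open_Collect_less continuous_intros)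
  have Sh1: "norm z < 1" if "z \<in> Sh" for z
    using that rad_less_1[of "2 * j + 2"] unfolding Sh_def by auto
  have kSh: "k \<in> Sh" using j by (simp add: Sh_def)
  have Fk: "F k = k" using line[of 0] Sh1[OF kSh] by simp
  have hol_ik: "line_holomorphic_on (\<lambda>z. coord_sum ik (F z)) (ball 0 1)"
    by (rule line_holomorphic_on_coord_sum[OF hol])
  then have cont_ik: "continuous_on (ball 0 1) (\<lambda>z. coord_sum ik (F z))"
    unfolding line_holomorphic_on_def by blast
  have "continuous_on (ball 0 1) (\<lambda>z. \<chi> i. F z $ i)"
    by (intro continuous_on_vec_lambda) (use hol in \<open>auto simp: line_holomorphic_on_def\<close>)
  then have "continuous_on (ball 0 1) F" by simp
  then have "open (ball 0 1 \<inter> F -` Sh)"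
    using \<open>open Sh\<close> by (intro continuous_open_preimage) auto
  then have "open (Sh \<inter> (ball 0 1 \<inter> F -` Sh))" using \<open>open Sh\<close> by blast
  moreover have "k \<in> Sh \<inter> (ball 0 1 \<inter> F -` Sh)" using kSh Sh1[OF kSh] Fk by simp
  \<comment> \<open>On \<open>ball k \<delta>\<close> both the points and their images stay in the
    open shell of the wall \<open>j\<close>, where the wall is the full hyperplane.\<close>
  ultimately obtain \<delta> where \<delta>: "\<delta> > 0" "ball k \<delta> \<subseteq> Sh \<inter> (ball 0 1 \<inter> F -` Sh)"
    using open_contains_ball by blast
  have ball1: "ball k \<delta> \<subseteq> ball 0 1" using \<delta> by blast

  \<comment> \<open>A point off the hyperplane belongs to \<open>walled_ball\<close>, hence so does
    its image, which therefore misses the wall.\<close>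
  have off: "Re (coord_sum ik (F z)) \<noteq> of_rat t" if z: "z \<in> ball k \<delta>" "Re (coord_sum ik z) \<noteq> of_rat t" for z
  proof -
    have r: "rad (2 * j) < rad (2 * j + 1)" "rad (2 * j + 2) < rad (2 * j + 3)" by simp_all
    have "z \<in> Sh" "F z \<in> Sh" using z \<delta> by auto
    then have "rad (2 * j + 1) < norm z" "norm z < rad (2 * j + 2)" by (simp_all add: Sh_def)
    with z(2) r have "z \<in> walled_ball"
      by (intro walled_ball_shell[of j]) (linarith, linarith, simp add: mem_wall_iff[OF j(1)])
    then have "F z \<notin> wall j" using maps unfolding walled_ball_def by blast
    with \<open>F z \<in> Sh\<close> show ?thesis by (auto simp: Sh_def mem_wall_iff[OF j(1)])
  qed

  \<comment> \<open>The half-ball \<open>P\<close> is convex and, by \<open>off\<close>,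
    \<open>h\<close> has no zero on it, so \<open>h\<close> keeps one sign there. The sign is read
    off at a point \<open>w\<close> of the fixed line.\<close>
  have side: "\<sigma> * (Re (coord_sum ik (F z)) - of_rat t) > 0"
    if \<sigma>: "\<bar>\<sigma>\<bar> = 1" and z: "z \<in> ball k \<delta>" "\<sigma> * (Re (coord_sum ik z) - of_rat t) > 0" for \<sigma> :: real and z
  proof (rule ccontr)
    assume neg: "\<not> \<sigma> * (Re (coord_sum ik (F z)) - of_rat t) > 0"
    define P where "P = {z \<in> ball k \<delta>. \<sigma> * (Re (coord_sum ik z) - of_rat t) > 0}"
    define h where "h = (\<lambda>z. \<sigma> * (Re (coord_sum ik (F z)) - of_rat t))"
    have "convex {z. \<sigma> * (Re (coord_sum ik z) - of_rat t) > 0}"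
    proof (rule convexI)
      fix x y :: "complex ^ 'n" and a b :: real
      assume *: "x \<in> {z. \<sigma> * (Re (coord_sum ik z) - of_rat t) > 0}" "y \<in> {z. \<sigma> * (Re (coord_sum ik z) - of_rat t) > 0}"
        "0 \<le> a" "0 \<le> b" "a + b = 1"
      have "\<sigma> * (Re (coord_sum ik (a *\<^sub>R x + b *\<^sub>R y)) - (a + b) * of_rat t)
          = a * (\<sigma> * (Re (coord_sum ik x) - of_rat t)) + b * (\<sigma> * (Re (coord_sum ik y) - of_rat t))"
        by (simp add: coord_sum_def algebra_simps)
      also have "\<dots> > 0" using * by (cases "a = 0") (auto intro: add_pos_nonneg mult_pos_pos)
      finally show "a *\<^sub>R x + b *\<^sub>R y \<in> {z. \<sigma> * (Re (coord_sum ik z) - of_rat t) > 0}" using * by simp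
    qed
    then have "convex (ball k \<delta> \<inter> {z. \<sigma> * (Re (coord_sum ik z) - of_rat t) > 0})" by (intro convex_Int convex_ball)
    then have "connected P" by (simp add: P_def Int_def convex_connected)
    moreover have "continuous_on P (\<lambda>z. coord_sum ik (F z))"
      by (rule continuous_on_subset[OF cont_ik]) (use ball1 in \<open>auto simp: P_def\<close>)
    then have "continuous_on P h"
      unfolding h_def by (intro continuous_on_mult continuous_on_diff continuous_on_Re continuous_on_const)
    ultimately have con: "connected (h ` P)" by (metis connected_continuous_image)
    \<comment> \<open>With this \<open>s\<close>, a step of \<open>\<sigma> * s / \<mu>\<close>
      along \<open>v\<close> stays within distance \<delta> and shifts \<open>coord_sum ik\<close>
      by \<open>\<sigma> * s\<close>.\<close>
    define s where "s = \<delta> * cmod \<mu> / (2 * (norm v + 1))"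
    have "s > 0" using \<delta> v by (simp add: s_def \<mu>_def add_nonneg_pos)
    define w where "w = k + (of_real (\<sigma> * s) / \<mu>) *s v"
    have "cmod (of_real (\<sigma> * s) / \<mu>) = s / cmod \<mu>"
      unfolding norm_divide norm_of_real abs_mult \<sigma> using \<open>s > 0\<close> by simp
    also have "\<dots> = \<delta> / (2 * (norm v + 1))" using v by (simp add: s_def \<mu>_def)
    finally have "norm ((of_real (\<sigma> * s) / \<mu>) *s v) = \<delta> * (norm v / (2 * (norm v + 1)))"
      unfolding norm_vector_scalar by simp
    also have "\<dots> < \<delta> * 1" using \<delta> by (intro mult_strict_left_mono) (auto simp: divide_less_eq add_nonneg_pos)
    finally have w: "w \<in> ball k \<delta>" by (simp add: w_def dist_norm)
    then have "F w = w" using line[of "of_real (\<sigma> * s) / \<mu>"] ball1 unfolding w_def by auto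
    moreover have "Re (coord_sum ik w) = of_rat t + \<sigma> * s"
      using v k by (simp add: w_def coord_sum_add coord_sum_scale \<mu>_def)
    moreover have "\<sigma> * \<sigma> = 1" using \<sigma> by (metis abs_mult_self_eq mult_1)
    ultimately have "w \<in> P" "h w > 0"
      using w \<open>s > 0\<close> by (simp_all add: P_def h_def mult.assoc[symmetric])
    moreover have "z \<in> P" "h z \<le> 0" using z neg by (simp_all add: P_def h_def)
    ultimately have "0 \<in> h ` P"
      using connected_contains_Icc[OF con, of "h z" "h w"] by force
    then obtain y where "y \<in> P" "h y = 0" by auto
    then have "y \<in> ball k \<delta>" "Re (coord_sum ik y) \<noteq> of_rat t" by (auto simp: P_def)
    from off[OF this] \<open>h y = 0\<close> \<sigma> show False by (auto simp: h_def)
  qed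

  \<comment> \<open>If \<open>F z\<close> lay strictly on one side, continuity would put there also
    the image of a point \<open>w\<close> slightly on the other side, against
    \<open>side\<close>.\<close>
  have on: "Re (coord_sum ik (F z)) = of_rat t" if z: "z \<in> ball k \<delta>" "Re (coord_sum ik z) = of_rat t" for z
  proof (rule ccontr)
    assume ne: "Re (coord_sum ik (F z)) \<noteq> of_rat t"
    define \<sigma> where "\<sigma> = sgn (Re (coord_sum ik (F z)) - of_rat t)"
    have \<sigma>: "\<bar>\<sigma>\<bar> = 1" using ne by (simp add: \<sigma>_def abs_sgn_eq)
    have pos: "\<sigma> * (Re (coord_sum ik (F z)) - of_rat t) > 0" using ne by (auto simp: \<sigma>_def sgn_if)
    define V where "V = ball k \<delta> \<inter> (\<lambda>z. \<sigma> * (Re (coord_sum ik (F z)) - of_rat t)) -` {0<..}"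
    have "open V"
      unfolding V_def using continuous_on_subset[OF cont_ik ball1]
      by (intro continuous_open_preimage continuous_on_mult continuous_on_diff continuous_on_Re continuous_on_const) auto
    moreover have "z \<in> V" using z pos by (simp add: V_def)
    ultimately obtain e where e: "e > 0" "ball z e \<subseteq> V" using open_contains_ball by blast
    define N where "N = norm (all_ones :: complex ^ 'n)"
    have "N > 0" using all_ones_nonzero by (simp add: N_def)
    define w where "w = z + of_real (- \<sigma> * (e / (2 * N))) *s all_ones"
    have "norm (of_real (- \<sigma> * (e / (2 * N))) *s all_ones :: complex ^ 'n) = e / 2"
      unfolding norm_vector_scalar N_def[symmetric] norm_of_real abs_mult abs_minus_cancel \<sigma>
      using e \<open>N > 0\<close> by simp
    then have "w \<in> ball z e" using e by (simp add: w_def dist_norm)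
    then have "w \<in> V" using e by blast
    have "Re (coord_sum ik w) - of_rat t = - \<sigma> * (e / N)"
      unfolding w_def coord_sum_add coord_sum_scale coord_sum_all_ones using z \<open>N > 0\<close> by simp
    then have "- \<sigma> * (Re (coord_sum ik w) - of_rat t) = \<bar>\<sigma>\<bar> * \<bar>\<sigma>\<bar> * (e / N)" by simp
    then have "- \<sigma> * (Re (coord_sum ik w) - of_rat t) > 0" using \<sigma> e \<open>N > 0\<close> by simp
    then have "- \<sigma> * (Re (coord_sum ik (F w)) - of_rat t) > 0"
      using side[of "- \<sigma>" w] \<sigma> \<open>w \<in> V\<close> by (simp add: V_def)
    with \<open>w \<in> V\<close> show False by (simp add: V_def)
  qed

  \<comment> \<open>Projection to the fixed line along the leaves: \<open>\<kappa> z\<close> is the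
    point of that line with the same \<open>coord_sum ik\<close> as \<open>z\<close>.\<close>
  define \<kappa> where "\<kappa> = (\<lambda>z. k + ((coord_sum ik z - coord_sum ik k) / \<mu>) *s v)"
  have "continuous_on UNIV \<kappa>"
    unfolding \<kappa>_def using v
    by (intro continuous_intros linear_continuous_on_compose[where g = "\<lambda>\<zeta>. \<zeta> *s v"]
        bounded_linear.linear bounded_linear_vector_scalar_left) (auto simp: \<mu>_def)
  then have "open (ball k \<delta> \<inter> \<kappa> -` ball k \<delta>)" by (intro open_Int open_vimage) auto
  moreover have "k \<in> ball k \<delta> \<inter> \<kappa> -` ball k \<delta>" using \<delta> by (simp add: \<kappa>_def)
  ultimately obtain \<delta>' where \<delta>': "\<delta>' > 0" "ball k \<delta>' \<subseteq> ball k \<delta> \<inter> \<kappa> -` ball k \<delta>"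
    using open_contains_ball by blast

  \<comment> \<open>The complex line through \<open>\<kappa> z\<close> and \<open>z\<close> lies in
    one leaf of the hyperplane. There \<open>on\<close> fixes the real part, so the holomorphic
    function is constant, and its value is known at the fixed point
    \<open>\<kappa> z\<close>.\<close>
  have leaf: "coord_sum ik (F z) = coord_sum ik z" if z: "z \<in> ball k \<delta>'" "Re (coord_sum ik z) = of_rat t" for z
  proof -
    let ?S = "{\<zeta>. \<kappa> z + \<zeta> *s (z - \<kappa> z) \<in> ball k \<delta>}"
    let ?\<phi> = "\<lambda>\<zeta>. coord_sum ik (F (\<kappa> z + \<zeta> *s (z - \<kappa> z)))"
    have zk: "z \<in> ball k \<delta>" "\<kappa> z \<in> ball k \<delta>" using z \<delta>' by auto
    have ik_\<kappa>: "coord_sum ik (\<kappa> z) = coord_sum ik z"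
      using v by (simp add: \<kappa>_def coord_sum_add coord_sum_scale \<mu>_def)
    have "?\<phi> 1 = ?\<phi> 0"
    proof (rule holomorphic_Re_constant[of ?S ?\<phi> "of_rat t" 1 0])
      show "open ?S" by (rule open_complex_line_vimage) simp
      show "connected ?S" by (intro convex_connected convex_complex_line_vimage) simp
      show "?\<phi> holomorphic_on ?S"
        by (rule line_holomorphic_on_line[OF hol_ik]) (use ball1 in blast)
      show "1 \<in> ?S" "0 \<in> ?S" using zk by simp_all
      fix \<zeta> assume "\<zeta> \<in> ?S"
      then show "Re (?\<phi> \<zeta>) = of_rat t"
        using z by (intro on) (simp_all add: coord_sum_add coord_sum_scale coord_sum_diff ik_\<kappa>)
    qed
    moreover have "F (\<kappa> z) = \<kappa> z"
      using line[of "(coord_sum ik z - coord_sum ik k) / \<mu>"] zk(2) ball1 unfolding \<kappa>_def by auto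
    ultimately show ?thesis by (simp add: ik_\<kappa>)
  qed

  \<comment> \<open>The parameter at which the line through \<open>z\<close> in direction
    \<open>all_ones\<close> reaches the hyperplane.\<close>
  define \<tau> where "\<tau> = (\<lambda>z. complex_of_real ((of_rat t - Re (coord_sum ik z)) / 2))"
  have "continuous_on UNIV (\<lambda>z. z + \<tau> z *s all_ones)"
    unfolding \<tau>_def
    by (intro continuous_intros linear_continuous_on_compose[where g = "\<lambda>\<zeta>. \<zeta> *s all_ones"]
        bounded_linear.linear bounded_linear_vector_scalar_left) auto
  then have "open (ball k \<delta>' \<inter> (\<lambda>z. z + \<tau> z *s all_ones) -` ball k \<delta>')" by (intro open_Int open_vimage) auto
  moreover have "k \<in> ball k \<delta>' \<inter> (\<lambda>z. z + \<tau> z *s all_ones) -` ball k \<delta>'" using \<delta>' k by (simp add: \<tau>_def)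
  ultimately obtain \<epsilon> where \<epsilon>: "\<epsilon> > 0" "ball k \<epsilon> \<subseteq> ball k \<delta>' \<inter> (\<lambda>z. z + \<tau> z *s all_ones) -` ball k \<delta>'"
    using open_contains_ball by blast

  \<comment> \<open>On that line the parameters of points in the hyperplane lie on a real line and
    accumulate at \<open>\<tau> z\<close>. \<open>leaf\<close> settles them, and the one-variable
    identity theorem carries the equation to the parameter 0.\<close>
  have near: "coord_sum ik (F z) = coord_sum ik z" if z: "z \<in> ball k \<epsilon>" for z
  proof -
    let ?S = "{\<zeta>. z + \<zeta> *s all_ones \<in> ball k \<delta>'}"
    let ?\<phi> = "\<lambda>\<zeta>. coord_sum ik (F (z + \<zeta> *s all_ones)) - (coord_sum ik z + 2 * \<zeta>)"
    let ?U = "{\<zeta> \<in> ?S. Re (coord_sum ik z) + 2 * Re \<zeta> = of_rat t}"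
    have S: "open ?S" by (rule open_complex_line_vimage) simp
    have \<tau>S: "\<tau> z \<in> ?S" using z \<epsilon> by auto
    have "?\<phi> 0 = 0"
    proof (rule analytic_continuation[OF _ S, of ?\<phi> ?U "\<tau> z"])
      show "connected ?S" by (intro convex_connected convex_complex_line_vimage) simp
      have "ball k \<delta>' \<subseteq> ball 0 1" using ball1 \<delta>' by blast
      then have "(\<lambda>\<zeta>. coord_sum ik (F (z + \<zeta> *s all_ones))) holomorphic_on ?S"
        by (intro line_holomorphic_on_line[OF hol_ik]) blast
      then show "?\<phi> holomorphic_on ?S" by (intro holomorphic_intros)
      show "\<tau> z islimpt ?U"
        unfolding islimpt_approachable
      proof (intro allI impI)
        fix e :: real assume "e > 0"
        obtain r where r: "r > 0" "ball (\<tau> z) r \<subseteq> ?S" using S \<tau>S open_contains_ball by blast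
        define \<zeta> where "\<zeta> = \<tau> z + \<i> * of_real (min r e / 2)"
        have d: "dist \<zeta> (\<tau> z) = min r e / 2" using r \<open>e > 0\<close> by (simp add: \<zeta>_def dist_norm norm_mult)
        then have "\<zeta> \<in> ball (\<tau> z) r" using r \<open>e > 0\<close> by (simp add: dist_commute)
        then have "\<zeta> \<in> ?S" using r by blast
        moreover have "Re (\<tau> z) = (of_rat t - Re (coord_sum ik z)) / 2"
          unfolding \<tau>_def by (rule Re_complex_of_real)
        then have "Re (coord_sum ik z) + 2 * Re \<zeta> = of_rat t" by (simp add: \<zeta>_def field_simps)
        ultimately have "\<zeta> \<in> ?U" by blast
        then show "\<exists>x'\<in>?U. x' \<noteq> \<tau> z \<and> dist x' (\<tau> z) < e"
          using d r \<open>e > 0\<close> by (intro bexI[of _ \<zeta>]) auto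
      qed
      fix \<zeta> assume "\<zeta> \<in> ?U"
      then show "?\<phi> \<zeta> = 0"
        using leaf[of "z + \<zeta> *s all_ones"] by (simp add: coord_sum_add coord_sum_scale coord_sum_all_ones)
    qed (use z \<epsilon> \<tau>S in auto)
    then show ?thesis by simp
  qed
  show ?thesis
  proof (rule line_holomorphic_identity[of "ball 0 1" _ _ "ball k \<epsilon>"])
    show "ball k \<epsilon> \<subseteq> ball 0 1" using \<epsilon> \<delta>' ball1 by blast
    show "line_holomorphic_on (coord_sum ik) (ball 0 1)" by (rule line_holomorphic_on_coord_sum_id)
  qed (use \<epsilon> z near hol_ik in auto)
qed

text \<open>A rational level \<open>t\<close> is attained inside the slice at a real parameter
  \<open>x\<close>. As the pair recurs, some wall of this type lies in a shell farther out than that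
  point; varying \<open>y\<close> keeps the level and raises the norm to the middle radius
  \<open>M\<close> of this shell.\<close>

lemma slice_meets_wall:
  fixes c v :: "complex ^ 'n"
  assumes v: "norm v = 1" and c: "hermitian c v = 0" "norm c < 1" and \<mu>: "coord_sum ik v \<noteq> 0"
  obtains j t \<zeta> where "wall_index j = (ik, t)" "rad (2 * j + 1) < norm (c + \<zeta> *s v)"
    "norm (c + \<zeta> *s v) < rad (2 * j + 2)" "Re (coord_sum ik (c + \<zeta> *s v)) = of_rat t"
proof -
  define m where "m = cmod (coord_sum ik v)"
  have m: "m > 0" using \<mu> by (simp add: m_def)
  \<comment> \<open>Rotates the parameter so that the real part of \<open>coord_sum ik\<close> along
    the slice depends on \<open>x\<close> alone.\<close>
  define \<theta> where "\<theta> = cnj (coord_sum ik v) / of_real m"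
  have \<theta>: "cmod \<theta> = 1" using m by (simp add: \<theta>_def norm_divide m_def)
  have \<theta>\<mu>: "coord_sum ik v * \<theta> = of_real m"
    using m by (simp add: \<theta>_def m_def complex_norm_square[symmetric] power2_eq_square)
  define R where "R = sqrt (1 - (norm c)\<^sup>2)"
  have R: "R > 0" "R\<^sup>2 = 1 - (norm c)\<^sup>2" using c by (simp_all add: R_def abs_square_less_1 less_imp_le)
  have "Re (coord_sum ik c) < Re (coord_sum ik c) + m * R" using m R by simp
  then obtain t where t: "Re (coord_sum ik c) < of_rat t" "of_rat t < Re (coord_sum ik c) + m * R"
    using of_rat_dense by blast
  define x where "x = (of_rat t - Re (coord_sum ik c)) / m"
  have x: "0 < x" "x < R" using t m by (simp_all add: x_def field_simps)
  then have "x\<^sup>2 < R\<^sup>2" by (intro power_strict_mono) auto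
  then have "sqrt ((norm c)\<^sup>2 + x\<^sup>2) < 1" using R by simp
  then obtain l where l: "\<And>k. l \<le> k \<Longrightarrow> sqrt ((norm c)\<^sup>2 + x\<^sup>2) < rad k"
    using rad_exceeds by metis
  obtain j where j: "l \<le> j" "wall_index j = (ik, t)" using wall_index_recurs by blast
  define M where "M = (rad (2 * j + 1) + rad (2 * j + 2)) / 2"
  have "rad (2 * j + 1) < rad (2 * j + 2)" by simp
  then have M: "rad (2 * j + 1) < M" "M < rad (2 * j + 2)" by (simp_all add: M_def)
  have "M > 0" using M rad_pos[of "2 * j + 1"] by linarith
  have "sqrt ((norm c)\<^sup>2 + x\<^sup>2) < M" using l[of "2 * j + 1"] j M by simp
  then have "(sqrt ((norm c)\<^sup>2 + x\<^sup>2))\<^sup>2 < M\<^sup>2" by (intro power_strict_mono) auto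
  then have less: "(norm c)\<^sup>2 + x\<^sup>2 < M\<^sup>2" by simp
  define y where "y = sqrt (M\<^sup>2 - (norm c)\<^sup>2 - x\<^sup>2)"
  have y: "y\<^sup>2 = M\<^sup>2 - (norm c)\<^sup>2 - x\<^sup>2" using less by (simp add: y_def)
  define \<zeta> where "\<zeta> = \<theta> * Complex x y"
  have "(norm (c + \<zeta> *s v))\<^sup>2 = M\<^sup>2"
    unfolding norm_slice[OF v c(1)] by (simp add: \<zeta>_def norm_mult \<theta> cmod_power2 y)
  then have n: "norm (c + \<zeta> *s v) = M" using \<open>M > 0\<close> by (simp add: power2_eq_iff_nonneg)
  have "\<zeta> * coord_sum ik v = of_real m * Complex x y" using \<theta>\<mu> by (simp add: \<zeta>_def mult.commute mult.left_commute)
  then have "Re (coord_sum ik (c + \<zeta> *s v)) = of_rat t"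
    using m by (simp add: coord_sum_add coord_sum_scale x_def)
  with j(2) n M that show thesis by metis
qed

text \<open>Where \<open>v $ k \<noteq> 0\<close> the pair \<open>(k, k)\<close> gives the
  coordinate. Where \<open>v $ k = 0\<close>, the pair \<open>(i, k)\<close> with
  \<open>v $ i \<noteq> 0\<close> is still admissible and gives coordinate \<open>k\<close> from
  coordinate \<open>i\<close>.\<close>

lemma coord_sum_separates:
  fixes v z w :: "complex ^ 'n"
  assumes v: "v \<noteq> 0" and eq: "\<And>ik. coord_sum ik v \<noteq> 0 \<Longrightarrow> coord_sum ik z = coord_sum ik w"
  shows "z = w"
proof -
  obtain i where i: "v $ i \<noteq> 0" using v by (auto simp: vec_eq_iff)
  have diag: "z $ k = w $ k" if "v $ k \<noteq> 0" for k
    using eq[of "(k, k)"] that by (simp add: coord_sum_def)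
  have "z $ k = w $ k" for k
  proof (cases "v $ k = 0")
    case True
    then show ?thesis using eq[of "(i, k)"] i diag[OF i] by (simp add: coord_sum_def)
  qed (rule diag)
  then show ?thesis by (simp add: vec_eq_iff)
qed

lemma walled_ball_fixed_points:
  fixes f :: "complex ^ 'n \<Rightarrow> complex ^ 'n"
  assumes card: "CARD('n) \<ge> 2" and f: "holomorphic_map_on f walled_ball" "f ` walled_ball \<subseteq> walled_ball"
    and pq: "p \<in> walled_ball" "q \<in> walled_ball" "p \<noteq> q" "f p = p" "f q = q"
    and z: "z \<in> walled_ball"
  shows "f z = z"
proof -
  have "\<exists>G. line_holomorphic_on G (ball 0 1) \<and> (\<forall>z\<in>walled_ball. G z = f z $ i)" for i
    using walled_ball_extension[OF card line_holomorphic_on_component[OF f(1)]] by metis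
  then obtain G where G: "\<And>i. line_holomorphic_on (G i) (ball 0 1)"
    "\<And>i z. z \<in> walled_ball \<Longrightarrow> G i z = f z $ i" by metis
  define F where "F = (\<lambda>z. \<chi> i. G i z)"
  have Ff: "F z = f z" if "z \<in> walled_ball" for z
    using G(2)[OF that] by (simp add: F_def vec_eq_iff)
  have hol: "line_holomorphic_on (\<lambda>z. F z $ i) (ball 0 1)" for i using G(1) by (simp add: F_def)
  have sub: "z \<in> walled_ball \<Longrightarrow> norm z < 1" for z :: "complex ^ 'n" by (simp add: walled_ball_def)
  \<comment> \<open>\<open>F z\<close> is a limit of points of the open ball; the closed ball is all
    that \<open>ball_map_fixes_slice\<close> asks for.\<close>
  have le: "norm (F z) \<le> 1" if "norm z < 1" for z
  proof (rule Lim_norm_ubound)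
    have "continuous_on (ball 0 1) F"
      unfolding F_def by (intro continuous_on_vec_lambda) (use G(1) in \<open>auto simp: line_holomorphic_on_def\<close>)
    then have "isCont F z" using that by (simp add: continuous_on_eq_continuous_at)
    then show "(F \<longlongrightarrow> F z) (at z within walled_ball)"
      by (auto simp: isCont_def intro: tendsto_within_subset)
    show "at z within walled_ball \<noteq> bot"
      using islimpt_walled_ball[OF that] by (simp add: trivial_limit_within)
    show "eventually (\<lambda>w. norm (F w) \<le> 1) (at z within walled_ball)"
      using Ff f(2) sub by (auto simp: eventually_at_topological less_imp_le image_subset_iff)
  qed
  obtain c v x d where v: "norm v = 1" and c: "hermitian c v = 0" "norm c < 1" and d: "d > 0"
    and line: "\<And>\<zeta>. p + \<zeta> *s (q - p) = c + (x + \<zeta> * of_real d) *s v"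
    using slice_normal_form[OF pq(3) sub[OF pq(1)]] by metis
  have fixed: "F (c + \<zeta> *s v) = c + \<zeta> *s v" if "norm (c + \<zeta> *s v) < 1" for \<zeta>
  proof -
    have "c + \<zeta> *s v = p + ((\<zeta> - x) / of_real d) *s (q - p)"
      unfolding line using d by simp
    then show ?thesis using that ball_map_fixes_slice[of F p q, OF hol le sub sub] pq Ff by metis
  qed
  have "coord_sum ik (F z) = coord_sum ik z" if ik: "coord_sum ik v \<noteq> 0" for ik
  proof -
    obtain j t \<zeta> where "wall_index j = (ik, t)" "rad (2 * j + 1) < norm (c + \<zeta> *s v)"
      "norm (c + \<zeta> *s v) < rad (2 * j + 2)" "Re (coord_sum ik (c + \<zeta> *s v)) = of_rat t"
      using slice_meets_wall[OF v c ik] by metis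
    then show ?thesis
    proof (intro wall_crossing[OF hol _ ik, of "c + \<zeta> *s v" j t])
      fix \<eta> assume *: "norm (c + \<zeta> *s v + \<eta> *s v) < 1"
      have "c + \<zeta> *s v + \<eta> *s v = c + (\<zeta> + \<eta>) *s v" by (simp add: vec_eq_iff algebra_simps)
      with * fixed show "F (c + \<zeta> *s v + \<eta> *s v) = c + \<zeta> *s v + \<eta> *s v" by metis
    qed (use Ff f(2) sub z in auto)
  qed
  then have "F z = z" using v by (intro coord_sum_separates[of v]) auto
  with Ff[OF z] show ?thesis by simp
qed

theorem theorem4p1:
  "\<exists>D :: (complex ^ 'n) set. is_domain D \<and> bounded D \<and>
     (\<forall>p\<in>D. \<forall>q\<in>D. p \<noteq> q \<longrightarrow>
        (\<forall>f :: complex ^ 'n \<Rightarrow> complex ^ 'n.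
           holomorphic_map_on f D \<and> f ` D \<subseteq> D \<and> f p = p \<and> f q = q \<longrightarrow>
           (\<forall>z\<in>D. f z = z)))"
proof (cases "CARD('n) \<ge> 2")
  case True
  have "is_domain (walled_ball :: (complex ^ 'n) set)"
    unfolding is_domain_def using open_walled_ball connected_walled_ball small_ball_walled_ball[of 0] rad_pos by auto
  moreover have "bounded (walled_ball :: (complex ^ 'n) set)"
    by (rule bounded_subset[OF bounded_ball[of 0 1]]) (auto simp: walled_ball_def)
  ultimately show ?thesis
    using walled_ball_fixed_points[OF True] by (intro exI[of _ walled_ball]) blast
next
  case False
  then have "CARD('n) = 1" using zero_less_card_finite[where 'a = 'n] by linarith
  then obtain i :: 'n where i: "UNIV = {i}" using card_1_singletonE by blast
  show ?thesis
  proof (intro exI[of _ "ball 0 1"] conjI ballI impI allI)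
    show "is_domain (ball (0 :: complex ^ 'n) 1)" by (simp add: is_domain_def)
    fix p q z :: "complex ^ 'n" and f :: "complex ^ 'n \<Rightarrow> complex ^ 'n"
    assume pq: "p \<in> ball 0 1" "q \<in> ball 0 1" "p \<noteq> q" and z: "z \<in> ball 0 1"
      and f: "holomorphic_map_on f (ball 0 1) \<and> f ` ball 0 1 \<subseteq> ball 0 1 \<and> f p = p \<and> f q = q"
    have all: "P i \<Longrightarrow> P k" for P k using i by (metis UNIV_I singletonD)
    \<comment> \<open>In dimension one the complex line through \<open>p\<close> and
      \<open>q\<close> is the whole space, so the slice fixed pointwise is the whole ball.\<close>
    define \<zeta> where "\<zeta> = (z - p) $ i / (q - p) $ i"
    have "(q - p) $ i \<noteq> 0" using pq(3) all[of "\<lambda>k. (q - p) $ k = 0"] by (auto simp: vec_eq_iff)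
    then have "\<zeta> * (q - p) $ i = (z - p) $ i" by (simp add: \<zeta>_def)
    then have "(p + \<zeta> *s (q - p)) $ i = z $ i"
      unfolding vector_add_component vector_smult_component by simp
    then have "z = p + \<zeta> *s (q - p)"
      unfolding vec_eq_iff using all[of "\<lambda>k. z $ k = (p + \<zeta> *s (q - p)) $ k"] by simp
    moreover have "norm (f w) \<le> 1" if "norm w < 1" for w
      using f that by (auto simp: image_subset_iff less_imp_le)
    ultimately show "f z = z"
      using ball_map_fixes_slice[of f p q \<zeta>] line_holomorphic_on_component[of f "ball 0 1"] f pq z
      by simp
  qed simp
qed

end
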